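(* Let $n\ge2$ be an integer, $N=2n+1$, $m_0=+1$ or $-1$, and $m_j=m_0$ for $1\le j\le N=2n+1$. Let $0\le\theta_0<2\pi$ and $0<a_1<a_2$ be constants, $C_1=\frac12(a_1^2+a_2^2)$, $C_2=\frac12(a_2^2-a_1^2)$, and $\theta_n^j=\frac{2(j-1)\pi}{n}+\theta_0$ for $1\le j\le n$. Consider the system $$\dot{\mathbf x}_j(t)=2m_j\sum_{k=1,k\ne j}^N m_k\frac{\mathbf x_j(t)-\mathbf x_k(t)}{|\mathbf x_j(t)-\mathbf x_k(t)|^2},\qquad 1\le j\le N,\quad t>0,$$ with initial data $$\mathbf x_N(0)=\mathbf 0,\qquad \mathbf x_j(0)=a_1(\cos\theta_n^j,\sin\theta_n^j)^T,\qquad \mathbf x_{n+j}(0)=a_2(\cos\theta_n^j,\sin\theta_n^j)^T,\qquad 1\le j\le n.$$ Then the solution can be given as $$\mathbf x_N(t)\equiv\mathbf 0,\qquad \mathbf x_j(t)=\sqrt{\rho_1(t)}\,(\cos\theta_n^j,\sin\theta_n^j)^T,\qquad \mathbf x_{n+j}(t)=\sqrt{\rho_2(t)}\,(\cos\theta_n^j,\sin\theta_n^j)^T,\qquad 1\le j\le n,$$ where, when $n=2$, $$\rho_1(t)=C_1+10t-\sqrt{C_2^2+8C_1t+40t^2},\qquad \rho_2(t)=C_1+10t+\sqrt{C_2^2+8C_1t+40t^2},\qquad t\ge0;$$ and when $n\ge3$, $$\rho_1(t)\sim\alpha_3t,\qquad \rho_2(t)\sim\beta_3t,\qquad t\gg1,$$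 with $\alpha_3$ and $\beta_3$ being two positive constants satisfying $$0<\alpha_3<\beta_3,\qquad \alpha_3+\beta_3=8n+4,\qquad \beta_3-\alpha_3=4n\,\frac{\beta_3^{n/2}+\alpha_3^{n/2}}{\beta_3^{n/2}-\alpha_3^{n/2}} .$$ Specifically, when $n\gg1$, $\alpha_3\approx2n+2$ and $\beta_3\approx6n+2$.
   Context: Here $\mathbf x_j(t)\in\mathbb R^2$ is the center of the $j$-th of $N$ quantized vortices and $m_j\in\{+1,-1\}$ is its winding number. The notation $f(t)\sim g(t)$, $t\gg1$, is the usual notation for asymptotic behaviour at large time. The symbol $\approx$ for $n\gg1$ denotes approximate equality for large $n$, with no quantitative error specified. *)

theory Defs
  imports "HOL-Analysis.Analysis" "HOL-Library.Landau_Symbols"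
begin

text \<open>
  A global classical solution of the reduced dynamical law of \<open>N\<close> vortices with winding
  numbers \<open>m\<close>, starting at \<open>x0\<close>. The vortices are indexed by \<open>{1..N}\<close>; the values of
  \<open>x j\<close> for other \<open>j\<close>, and at negative times, are irrelevant. Absence of collisions is
  required because the right-hand side is only defined for pairwise distinct centers
  (in HOL a colliding pair would silently contribute \<open>0\<close>).
\<close>

definition vortex_solution ::
  "nat \<Rightarrow> (nat \<Rightarrow> int) \<Rightarrow> (nat \<Rightarrow> real ^ 2) \<Rightarrow> (nat \<Rightarrow> real \<Rightarrow> real ^ 2) \<Rightarrow> bool" where
  "vortex_solution N m x0 x \<longleftrightarrow>
     (\<forall>j\<in>{1..N}. x j 0 = x0 j) \<and>
     (\<forall>j\<in>{1..N}. continuous_on {0..} (x j)) \<and>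
     (\<forall>t\<ge>0. \<forall>j\<in>{1..N}. \<forall>k\<in>{1..N}. j \<noteq> k \<longrightarrow> x j t \<noteq> x k t) \<and>
     (\<forall>t>0. \<forall>j\<in>{1..N}.
        (x j has_vector_derivative
           (2 * of_int (m j)) *\<^sub>R
             (\<Sum>k\<in>{1..N} - {j}.
                (of_int (m k) / (norm (x j t - x k t))\<^sup>2) *\<^sub>R (x j t - x k t))) (at t))"

definition theta :: "nat \<Rightarrow> real \<Rightarrow> nat \<Rightarrow> real" where
  "theta n \<theta>\<^sub>0 j = 2 * (real j - 1) * pi / real n + \<theta>\<^sub>0"

text \<open>
  Points \<open>1..n\<close> on a circle of radius \<open>r1\<close>, points \<open>n+1..2n\<close> at the same angles on a
  circle of radius \<open>r2\<close>, and point \<open>2n+1\<close> at the origin.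
\<close>

definition two_rings :: "nat \<Rightarrow> real \<Rightarrow> real \<Rightarrow> real \<Rightarrow> nat \<Rightarrow> real ^ 2" where
  "two_rings n \<theta>\<^sub>0 r1 r2 j =
     (if j \<in> {1..n} then
        r1 *\<^sub>R vector [cos (theta n \<theta>\<^sub>0 j), sin (theta n \<theta>\<^sub>0 j)]
      else if j \<in> {n+1..2*n} then
        r2 *\<^sub>R vector [cos (theta n \<theta>\<^sub>0 (j - n)), sin (theta n \<theta>\<^sub>0 (j - n))]
      else 0)"

end

theory Submission
  imports Defs "HOL-Real_Asymp.Real_Asymp"
begin

text \<open>
  Identify the plane with the complex numbers. The velocity of the vortex at \<open>z\<close> is twice the
  conjugate of the sum of \<open>1 / (z - w)\<close> over the other vortices \<open>w\<close>, and over the points of a ring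
  this sum is a logarithmic derivative: \<open>n z ^ (n-1) / (z ^ n - w ^ n)\<close>. Hence the two-ring shape is
  preserved and the system reduces to two equations for the squared radii. Their sum grows
  linearly; for \<open>n = 2\<close> this integrates the system explicitly, and for general \<open>n\<close> the ratio
  \<open>q = \<rho>\<^sub>1 / \<rho>\<^sub>2\<close> solves, in logarithmic time, a scalar autonomous equation with a single
  equilibrium in the unit interval, which attracts every solution and determines both rates. This equation
  is solved globally by separation of variables. Uniqueness follows from Gronwall's inequality, since
  the inversion \<open>x / |x|\<^sup>2\<close> is Lipschitz away from the origin and there are no collisions on compact time intervals.
\<close>

subsection \<open>Scalar autonomous equations\<close>

text \<open>Separation of variables: \<open>y\<close> is the inverse of the travel time
  \<open>T u\<close>, the integral of \<open>1 / f\<close> from \<open>a\<close> to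
  \<open>u\<close>. Differentiability at the zero \<open>b\<close> bounds \<open>f\<close> there by
  a multiple of \<open>b - u\<close>, so \<open>T\<close> is unbounded near \<open>b\<close>. Hence
  \<open>y\<close> exists for all times and tends to \<open>b\<close> without reaching it.\<close>

lemma increasing_flow:
  fixes f :: "real \<Rightarrow> real"
  assumes ab: "a < b" and cont: "continuous_on {a..b} f"
    and pos: "\<And>u. a \<le> u \<Longrightarrow> u < b \<Longrightarrow> 0 < f u" and fb: "f b = 0"
    and deriv: "(f has_real_derivative f') (at b within {a..b})"
  obtains y where "y 0 = a" "continuous_on {0..} y" "\<And>t. 0 \<le> t \<Longrightarrow> y t \<in> {a..<b}"
    "\<And>t. 0 < t \<Longrightarrow> (y has_real_derivative f (y t)) (at t)" "(y \<longlongrightarrow> b) at_top"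
proof -
  \<comment> \<open>The difference quotient of \<open>f\<close> at \<open>b\<close>, completed by
    its limit \<open>f'\<close>. Its continuity on the compact interval gives the linear bound
    \<open>fL\<close>.\<close>
  define k where "k u = (if u = b then f' else f u / (u - b))" for u
  have "continuous_on {a..b} k"
    unfolding continuous_on_eq_continuous_within
  proof
    fix u assume u: "u \<in> {a..b}"
    show "continuous (at u within {a..b}) k"
    proof (cases "u = b")
      case True
      have "((\<lambda>v. (f v - f b) / (v - b)) \<longlongrightarrow> f') (at b within {a..b})"
        using deriv by (simp add: has_field_derivative_iff)
      then have "(k \<longlongrightarrow> f') (at b within {a..b})"
        by (rule Lim_transform_eventually) (auto simp: eventually_at_filter k_def fb)
      then show ?thesis using True by (simp add: continuous_within k_def)
    next
      case False
      have fu: "continuous (at u within {a..b}) f"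
        using cont u by (simp add: continuous_on_eq_continuous_within)
      have "continuous (at u within {a..b}) (\<lambda>v. f v / (v - b))"
        by (intro continuous_intros fu) (use False in auto)
      moreover have "\<forall>\<^sub>F v in at u within {a..b}. k v = f v / (v - b)"
        using eventually_neq_at_within[of b u] by eventually_elim (simp add: k_def)
      ultimately show ?thesis
        using False by (simp add: continuous_within k_def tendsto_cong)
    qed
  qed
  then have "bounded (k ` {a..b})"
    by (intro compact_imp_bounded compact_continuous_image) auto
  then obtain L where L: "0 < L" "\<And>u. u \<in> {a..b} \<Longrightarrow> \<bar>k u\<bar> \<le> L"
    by (auto simp: bounded_pos)
  have fL: "f u \<le> L * (b - u)" if "a \<le> u" "u < b" for u
  proof -
    have "f u / (b - u) \<le> L"
      using L(2)[of u] pos[OF that] that by (simp add: k_def)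
    then show ?thesis using that by (simp add: field_simps)
  qed
  define T where "T u = integral {a..u} (\<lambda>v. 1 / f v)" for u
  have T_deriv_within: "(T has_real_derivative 1 / f u) (at u within {a..c})"
    if "u \<in> {a..c}" "c < b" for u c
    unfolding T_def
  proof (rule integral_has_real_derivative)
    have "continuous_on {a..c} f" using cont that by (auto intro: continuous_on_subset)
    then show "continuous_on {a..c} (\<lambda>v. 1 / f v)"
      using pos that by (intro continuous_intros) force+
  qed (use that in auto)
  have T_deriv: "(T has_real_derivative 1 / f u) (at u)" if "a < u" "u < b" for u
  proof -
    have "(T has_real_derivative 1 / f u) (at u within {a..(u+b)/2})"
      using that by (intro T_deriv_within) auto
    then show ?thesis using that by (simp add: at_within_Icc_at)
  qed
  have T_cont: "continuous_on {a..c} T" if "c < b" for c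
    by (rule DERIV_continuous_on) (rule T_deriv_within[OF _ that])
  have Ta: "T a = 0" by (simp add: T_def)
  have T_mono: "T u < T v" if "a \<le> u" "u < v" "v < b" for u v
  proof (rule DERIV_pos_imp_increasing_open[OF that(2)])
    show "\<exists>y. (T has_real_derivative y) (at x) \<and> 0 < y" if "u < x" "x < v" for x
      using T_deriv[of x] pos[of x] that \<open>a \<le> u\<close> \<open>v < b\<close> by fastforce
    show "continuous_on {u..v} T"
      using T_cont[OF that(3)] that by (auto intro: continuous_on_subset)
  qed
  have T_large: "\<exists>u\<in>{a..<b}. t \<le> T u" if t: "0 \<le> t" for t
  proof
    \<comment> \<open>The witness \<open>u\<close> is the position at time \<open>t\<close> of the
      solution of \<open>v' = L * (b - v)\<close> started at \<open>a\<close>. It moves at least as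
      fast as the flow of \<open>f\<close>, which therefore needs time at least \<open>t\<close> to
      reach \<open>u\<close>.\<close>
    define X where "X = exp (- (L * t))"
    define u where "u = b - (b - a) * X"
    have X: "0 < X" "X \<le> 1" using L(1) t by (simp_all add: X_def)
    have "(b - a) * X \<le> b - a"
      using ab X mult_left_le[of X "b - a"] by simp
    then have "a \<le> u" unfolding u_def by linarith
    moreover have "u < b" using ab X by (simp add: u_def)
    ultimately show u: "u \<in> {a..<b}" by simp
    \<comment> \<open>The travel time of \<open>f\<close> minus that of the comparison equation, up
      to a constant; \<open>fL\<close> makes it nondecreasing.\<close>
    define H where "H v = T v + ln (b - v) / L" for v
    have "H a \<le> H u"
    proof (cases "a = u")
      case False
      show ?thesis
      proof (rule DERIV_nonneg_imp_increasing_open[of a u H])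
        show "a \<le> u" using u by simp
        fix x assume x: "a < x" "x < u"
        have "(H has_real_derivative 1 / f x - 1 / (L * (b - x))) (at x)"
          unfolding H_def using x u L(1)
          by (auto intro!: derivative_eq_intros T_deriv simp: divide_simps)
        moreover have "1 / (L * (b - x)) \<le> 1 / f x"
          using fL[of x] pos[of x] x u by (intro divide_left_mono) auto
        ultimately show "\<exists>y. (H has_real_derivative y) (at x) \<and> 0 \<le> y" by fastforce
      next
        show "continuous_on {a..u} H"
          unfolding H_def using u L(1) by (intro continuous_intros T_cont) auto
      qed
    qed simp
    moreover have "ln (b - u) = ln (b - a) - L * t"
      using ab by (simp add: u_def X_def ln_mult)
    ultimately show "t \<le> T u"
      using L(1) by (simp add: H_def Ta field_simps)
  qed
  have T_inj: "inj_on T {a..<b}"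
    by (rule linorder_inj_onI') (use T_mono in force)
  have T_surj: "t \<in> T ` {a..<b}" if t: "0 \<le> t" for t
  proof -
    obtain u where u: "u \<in> {a..<b}" "t \<le> T u" using T_large[OF t] by blast
    obtain v where "a \<le> v" "v \<le> u" "T v = t"
      using IVT'[of T a t u] T_cont[of u] u t by (auto simp: Ta)
    then show ?thesis using u by auto
  qed
  define y where "y = inv_into {a..<b} T"
  have y_in: "y t \<in> {a..<b}" and Ty: "T (y t) = t" if "0 \<le> t" for t
    using inv_into_into[OF T_surj[OF that]] f_inv_into_f[OF T_surj[OF that]] by (auto simp: y_def)
  have yT: "y (T u) = u" if "u \<in> {a..<b}" for u
    using that T_inj by (simp add: y_def)
  have T_less: "c < y t" if "a \<le> c" "c < b" "T c < t" "0 \<le> t" for c t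
  proof (rule ccontr)
    assume "\<not> c < y t"
    then have "T (y t) \<le> T c"
      using T_mono[of "y t" c] y_in[OF that(4)] that by (cases "y t = c") auto
    then show False using Ty that by simp
  qed
  \<comment> \<open>The inverse of a continuous injection on a compact interval is continuous. By
    \<open>y_large\<close> the intervals \<open>{0..T c}\<close> exhaust the half-line.\<close>
  have y_cont: "continuous_on {0..T c} y" if c: "a < c" "c < b" for c
  proof -
    have "continuous_on (T ` {a..c}) y"
      using c by (intro continuous_on_inv T_cont) (auto intro: yT)
    moreover have "{0..T c} \<subseteq> T ` {a..c}"
    proof
      fix t assume "t \<in> {0..T c}"
      then show "t \<in> T ` {a..c}"
        using IVT'[of T a t c] T_cont[of c] c by (auto simp: Ta)
    qed
    ultimately show ?thesis by (rule continuous_on_subset)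
  qed
  have y_large: "\<exists>c. a < c \<and> c < b \<and> t < T c" if t: "0 \<le> t" for t
  proof -
    obtain c where c: "y t < c" "c < b" using y_in[OF t] dense by auto
    then show ?thesis using T_mono[of "y t" c] y_in[OF t] Ty[OF t]
      by (intro exI[of _ c]) auto
  qed
  have cont_y: "continuous_on {0..} y"
    unfolding continuous_on_eq_continuous_within
  proof
    fix t :: real assume t: "t \<in> {0..}"
    then obtain c where c: "a < c" "c < b" "t < T c" using y_large by auto
    have "continuous (at t within {0..T c}) y"
      using y_cont[OF c(1,2)] t c by (simp add: continuous_on_eq_continuous_within)
    moreover have "at t within {0..T c} = at t within {0..}"
      by (rule at_within_nhd[of _ "{..<T c}"]) (use c in auto)
    ultimately show "continuous (at t within {0..}) y" by simp
  qed
  show thesis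
  proof (rule that[of y])
    show "y 0 = a" using yT[of a] ab by (simp add: Ta)
    show "continuous_on {0..} y" by (rule cont_y)
    show "y t \<in> {a..<b}" if "0 \<le> t" for t using y_in[OF that] .
    show "(y has_real_derivative f (y t)) (at t)" if t: "0 < t" for t
    proof -
      have "a < y t" using T_less[of a t] t ab by (simp add: Ta)
      then have 1: "(T has_real_derivative 1 / f (y t)) (at (y t))"
        using y_in[of t] t by (intro T_deriv) auto
      have "isCont y t"
        by (rule continuous_on_interior[OF cont_y]) (use t in simp)
      then have "(y has_real_derivative inverse (1 / f (y t))) (at t)"
        using 1 pos[of "y t"] y_in[of t] t Ty
        by (intro DERIV_inverse_function[where a = 0 and b = "t + 1"]) auto
      then show ?thesis by simp
    qed
    show "(y \<longlongrightarrow> b) at_top"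
    proof (rule order_tendstoI)
      fix l assume l: "l < b"
      define c where "c = max l a"
      have "\<forall>\<^sub>F t in at_top. max 0 (T c) < t" by (rule eventually_gt_at_top)
      then show "\<forall>\<^sub>F t in at_top. l < y t"
      proof eventually_elim
        case (elim t)
        then show ?case using T_less[of c t] l ab by (auto simp: c_def)
      qed
    next
      fix l assume l: "b < l"
      show "\<forall>\<^sub>F t in at_top. y t < l"
        by (rule eventually_mono[OF eventually_ge_at_top[of 0]]) (use y_in l in force)
    qed
  qed
qed

text \<open>The sign condition covers both sides of the equilibrium at once: the solution rises to
  \<open>b\<close> from the left, stays constant if it starts there, and the case of a start on the
  right is reduced to the first by reflection.\<close>

lemma attracting_flow:
  fixes f :: "real \<Rightarrow> real"
  assumes cont: "continuous_on (closed_segment a b) f"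
    and attract: "\<And>u. u \<in> closed_segment a b \<Longrightarrow> u \<noteq> b \<Longrightarrow> 0 < f u * (b - u)" and fb: "f b = 0"
    and deriv: "(f has_real_derivative f') (at b)"
  obtains y where "y 0 = a" "continuous_on {0..} y" "\<And>t. 0 \<le> t \<Longrightarrow> y t \<in> closed_segment a b"
    "\<And>t. 0 < t \<Longrightarrow> (y has_real_derivative f (y t)) (at t)" "(y \<longlongrightarrow> b) at_top"
proof (cases a b rule: linorder_cases)
  case less
  then have seg: "closed_segment a b = {a..b}" by (simp add: closed_segment_eq_real_ivl)
  have pos: "0 < f u" if "a \<le> u" "u < b" for u
    using attract[of u] that seg by (auto simp: zero_less_mult_iff)
  have d: "(f has_real_derivative f') (at b within {a..b})"
    using deriv by (rule has_field_derivative_at_within)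
  show thesis
  proof (rule increasing_flow[OF less cont[unfolded seg] pos fb d])
    fix y assume y: "y 0 = a" "continuous_on {0..} y" "\<And>t. 0 \<le> t \<Longrightarrow> y t \<in> {a..<b}"
      "\<And>t. 0 < t \<Longrightarrow> (y has_real_derivative f (y t)) (at t)" "(y \<longlongrightarrow> b) at_top"
    show thesis by (rule that[OF y(1,2) _ y(4,5)]) (use y(3) in \<open>force simp: seg\<close>)
  qed
next
  case equal
  then show thesis using that[of "\<lambda>_. a"] fb by auto
next
  case greater
  then have seg: "closed_segment a b = {b..a}" by (simp add: closed_segment_eq_real_ivl)
  \<comment> \<open>The reflection \<open>u \<mapsto> -u\<close> turns a descent to \<open>b\<close>
    into an ascent to \<open>-b\<close>.\<close>
  define g where "g u = - f (- u)" for u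
  have "continuous_on {-a..-b} g"
    unfolding g_def using cont seg
    by (intro continuous_intros continuous_on_compose2[OF cont]) auto
  moreover have "0 < g u" if "-a \<le> u" "u < -b" for u
    using attract[of "-u"] that seg by (auto simp: zero_less_mult_iff g_def)
  moreover have "(g has_real_derivative f') (at (-b) within {-a..-b})"
  proof -
    have "((\<lambda>u. f (- u)) has_real_derivative f' * (- 1)) (at (-b))"
      by (rule DERIV_chain2[where f = f]) (use deriv in \<open>auto intro!: derivative_eq_intros\<close>)
    from DERIV_minus[OF this] show ?thesis
      unfolding g_def by (auto intro: has_field_derivative_at_within)
  qed
  ultimately obtain y where y: "y 0 = -a" "continuous_on {0..} y"
    "\<And>t. 0 \<le> t \<Longrightarrow> y t \<in> {-a..<-b}"
    "\<And>t. 0 < t \<Longrightarrow> (y has_real_derivative g (y t)) (at t)" "(y \<longlongrightarrow> -b) at_top"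
    using increasing_flow[of "-a" "-b" g f'] greater fb by (auto simp: g_def)
  show thesis
  proof (rule that[of "\<lambda>t. - y t"])
    show "((\<lambda>t. - y t) has_real_derivative f (- y t)) (at t)" if "0 < t" for t
      using DERIV_minus[OF y(4)[OF that]] by (simp add: g_def)
    show "((\<lambda>t. - y t) \<longlongrightarrow> b) at_top" using tendsto_minus[OF y(5)] by simp
    show "- y t \<in> closed_segment a b" if "0 \<le> t" for t
      using y(3)[OF that] seg by auto
  qed (use y in \<open>auto intro: continuous_intros\<close>)
qed

subsection \<open>Uniqueness\<close>

text \<open>Both squared norms expand to the same expression in \<open>norm a\<close>,
  \<open>norm b\<close> and the inner product. The identity makes the vortex interaction Lipschitz
  as long as the distances stay bounded below.\<close>

lemma norm_inversion_diff:
  fixes a b :: "'a::real_inner"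
  assumes "a \<noteq> 0" "b \<noteq> 0"
  shows "norm ((1 / (norm a)\<^sup>2) *\<^sub>R a - (1 / (norm b)\<^sup>2) *\<^sub>R b) = norm (a - b) / (norm a * norm b)"
proof (rule power2_eq_imp_eq)
  define A B c where "A = norm a" "B = norm b" "c = a \<bullet> b"
  have AB: "A > 0" "B > 0" using assms by (auto simp: A_B_c_def)
  have sq: "a \<bullet> a = A\<^sup>2" "b \<bullet> b = B\<^sup>2" "a \<bullet> b = c" "b \<bullet> a = c"
    by (auto simp: A_B_c_def power2_norm_eq_inner inner_commute)
  have "(norm ((1 / A\<^sup>2) *\<^sub>R a - (1 / B\<^sup>2) *\<^sub>R b))\<^sup>2 = (A\<^sup>2 + B\<^sup>2 - 2 * c) / (A * B)\<^sup>2"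
    unfolding power2_norm_eq_inner using AB
    by (simp add: inner_diff sq divide_simps power2_eq_square algebra_simps)
  also have "A\<^sup>2 + B\<^sup>2 - 2 * c = (norm (a - b))\<^sup>2"
    unfolding power2_norm_eq_inner by (simp add: inner_diff sq)
  finally show "(norm ((1 / (norm a)\<^sup>2) *\<^sub>R a - (1 / (norm b)\<^sup>2) *\<^sub>R b))\<^sup>2 =
      (norm (a - b) / (norm a * norm b))\<^sup>2"
    by (simp add: A_B_c_def power_divide)
qed auto

lemma vortex_solution_continuous_on:
  assumes "vortex_solution N m x0 x" "j \<in> {1..N}"
  shows "continuous_on {0..t} (x j)"
proof (rule continuous_on_subset)
  show "continuous_on {0..} (x j)" using assms unfolding vortex_solution_def by blast
qed auto

text \<open>Gronwall's inequality for the sum \<open>E\<close> of the squared distances between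
  corresponding vortices. Without collisions the reciprocal mutual distances are continuous, hence
  bounded on \<open>{0..t}\<close>, and so the velocities are Lipschitz along the two
  solutions.\<close>

lemma vortex_solution_unique:
  assumes x: "vortex_solution N m x0 x" and y: "vortex_solution N m x0 y"
    and t: "0 \<le> t" and j: "j \<in> {1..N}"
  shows "x j t = y j t"
proof -
  have bound: "\<exists>B. \<forall>s\<in>{0..t}. \<forall>j\<in>{1..N}. \<forall>k\<in>{1..N}. 1 / norm (z j s - z k s) \<le> B"
    if z: "vortex_solution N m x0 z" for z
  proof -
    \<comment> \<open>One continuous function that dominates all reciprocal distances; its diagonal
      terms are \<open>1 / 0 = 0\<close>.\<close>
    define g where "g s = (\<Sum>j\<in>{1..N}. \<Sum>k\<in>{1..N}. 1 / norm (z j s - z k s))" for s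
    have "continuous_on {0..t} (\<lambda>s. 1 / norm (z j s - z k s))"
      if "j \<in> {1..N}" "k \<in> {1..N}" for j k
    proof (cases "j = k")
      case False
      have "continuous_on {0..t} (z i)" if "i \<in> {1..N}" for i
        using vortex_solution_continuous_on[OF z that] .
      then show ?thesis
        using z that False unfolding vortex_solution_def by (intro continuous_intros) auto
    qed simp
    then have "continuous_on {0..t} g"
      unfolding g_def by (intro continuous_on_sum) auto
    then have "bounded (g ` {0..t})"
      by (intro compact_imp_bounded compact_continuous_image) auto
    then obtain B where B: "\<And>s. s \<in> {0..t} \<Longrightarrow> g s \<le> B"
      by (auto simp: bounded_iff) (metis abs_le_D1 atLeastAtMost_iff)
    have "1 / norm (z j s - z k s) \<le> g s" if "j \<in> {1..N}" "k \<in> {1..N}" for j k s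
    proof -
      have "1 / norm (z j s - z k s) \<le> (\<Sum>k\<in>{1..N}. 1 / norm (z j s - z k s))"
        using that by (intro member_le_sum) auto
      also have "\<dots> \<le> g s"
        unfolding g_def
        by (rule member_le_sum[of j "{1..N}" "\<lambda>j. \<Sum>k\<in>{1..N}. 1 / norm (z j s - z k s)"])
          (use that in \<open>auto intro: sum_nonneg\<close>)
      finally show ?thesis .
    qed
    then show ?thesis using B by (intro exI[of _ B]) (metis order_trans)
  qed
  obtain Bx By where Bx: "\<And>s j k. s \<in> {0..t} \<Longrightarrow> j \<in> {1..N} \<Longrightarrow> k \<in> {1..N} \<Longrightarrow> 1 / norm (x j s - x k s) \<le> Bx"
    and By: "\<And>s j k. s \<in> {0..t} \<Longrightarrow> j \<in> {1..N} \<Longrightarrow> k \<in> {1..N} \<Longrightarrow> 1 / norm (y j s - y k s) \<le> By"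
    using bound[OF x] bound[OF y] by metis
  have Bx0: "0 \<le> Bx" and By0: "0 \<le> By"
    using Bx[of 0 j j] By[of 0 j j] t j by auto
  define M where "M = (\<Sum>j\<in>{1..N}. \<bar>real_of_int (m j)\<bar>)"
  have M: "\<bar>real_of_int (m j)\<bar> \<le> M" if "j \<in> {1..N}" for j
    unfolding M_def using that by (intro member_le_sum) auto
  have M0: "0 \<le> M" unfolding M_def by (intro sum_nonneg) auto
  define rhs :: "(nat \<Rightarrow> real \<Rightarrow> real^2) \<Rightarrow> nat \<Rightarrow> real \<Rightarrow> real^2" where
    "rhs z j s = (2 * of_int (m j)) *\<^sub>R
             (\<Sum>k\<in>{1..N} - {j}. (of_int (m k) / (norm (z j s - z k s))\<^sup>2) *\<^sub>R (z j s - z k s))" for z j s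
  define w where "w j s = x j s - y j s" for j s
  define E where "E s = (\<Sum>j\<in>{1..N}. w j s \<bullet> w j s)" for s
  \<comment> \<open>The factor \<open>2 * M * M\<close> bounds the coefficient of a pair, and
    \<open>Bx * By\<close> is the Lipschitz constant from
    \<open>norm_inversion_diff\<close>.\<close>
  define c where "c = 2 * M * M * Bx * By"
  have c0: "0 \<le> c" using M0 Bx0 By0 by (simp add: c_def)
  have lip: "norm (rhs x j s - rhs y j s) \<le> (\<Sum>k\<in>{1..N}. c * (norm (w j s) + norm (w k s)))"
    if s: "s \<in> {0..t}" and j: "j \<in> {1..N}" for j s
  proof -
    let ?K = "\<lambda>a::real^2. (1 / (norm a)\<^sup>2) *\<^sub>R a"
    have "rhs x j s - rhs y j s =
        (\<Sum>k\<in>{1..N} - {j}. (2 * of_int (m j) * of_int (m k)) *\<^sub>R (?K (x j s - x k s) - ?K (y j s - y k s)))"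
      unfolding rhs_def scaleR_diff_right[symmetric] sum_subtractf[symmetric] scaleR_sum_right
      by (intro sum.cong) (auto simp: algebra_simps)
    also have "norm \<dots> \<le> (\<Sum>k\<in>{1..N} - {j}. c * (norm (w j s) + norm (w k s)))"
    proof (rule sum_norm_le)
      fix k assume k: "k \<in> {1..N} - {j}"
      then have ne: "x j s - x k s \<noteq> 0" "y j s - y k s \<noteq> 0"
        using x y s j unfolding vortex_solution_def by auto
      have "norm (?K (x j s - x k s) - ?K (y j s - y k s))
          = norm (w j s - w k s) * ((1 / norm (x j s - x k s)) * (1 / norm (y j s - y k s)))"
        by (subst norm_inversion_diff[OF ne]) (simp add: w_def algebra_simps)
      also have "\<dots> \<le> (norm (w j s) + norm (w k s)) * (Bx * By)"
        using k j s Bx By Bx0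
        by (intro mult_mono norm_triangle_ineq4) auto
      finally have K: "norm (?K (x j s - x k s) - ?K (y j s - y k s)) \<le> (norm (w j s) + norm (w k s)) * (Bx * By)" .
      have "norm ((2 * of_int (m j) * of_int (m k)) *\<^sub>R (?K (x j s - x k s) - ?K (y j s - y k s)))
          = (2 * \<bar>of_int (m j)\<bar> * \<bar>of_int (m k)\<bar>) * norm (?K (x j s - x k s) - ?K (y j s - y k s))"
        by (simp add: abs_mult)
      also have "\<dots> \<le> (2 * M * M) * ((norm (w j s) + norm (w k s)) * (Bx * By))"
        using k j M M0 K by (intro mult_mono) auto
      finally show "norm ((2 * of_int (m j) * of_int (m k)) *\<^sub>R (?K (x j s - x k s) - ?K (y j s - y k s)))
          \<le> c * (norm (w j s) + norm (w k s))" by (simp add: c_def mult_ac)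
    qed
    also have "\<dots> \<le> (\<Sum>k\<in>{1..N}. c * (norm (w j s) + norm (w k s)))"
      using c0 by (intro sum_mono2) auto
    finally show ?thesis .
  qed
  \<comment> \<open>In \<open>2 * c * (3/2 * |w j|^2 + 1/2 * |w k|^2)\<close>, summed over all
    \<open>j\<close> and \<open>k\<close>, each square is counted \<open>N\<close> times, which
    gives \<open>2 * c * (3/2 + 1/2) * N\<close> times \<open>E s\<close>.\<close>
  define C where "C = 4 * c * real N"
  have E_deriv: "\<exists>D. (E has_real_derivative D) (at s) \<and> D \<le> C * E s" if s: "0 < s" "s \<le> t" for s
  proof (intro exI conjI)
    let ?D = "\<Sum>j\<in>{1..N}. 2 * (w j s \<bullet> (rhs x j s - rhs y j s))"
    have "(w j has_vector_derivative rhs x j s - rhs y j s) (at s)" if "j \<in> {1..N}" for j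
      using x y s that unfolding vortex_solution_def w_def rhs_def
      by (intro has_vector_derivative_diff) auto
    then have "((\<lambda>s. w j s \<bullet> w j s) has_real_derivative 2 * (w j s \<bullet> (rhs x j s - rhs y j s))) (at s)"
      if "j \<in> {1..N}" for j
      using that unfolding has_vector_derivative_def has_field_derivative_def
      by (auto intro!: derivative_eq_intros simp: inner_commute algebra_simps fun_eq_iff)
    then show "(E has_real_derivative ?D) (at s)"
      unfolding E_def by (intro DERIV_sum) auto
    have "?D \<le> (\<Sum>j\<in>{1..N}. \<Sum>k\<in>{1..N}. 2 * c * ((3/2) * (norm (w j s))\<^sup>2 + (1/2) * (norm (w k s))\<^sup>2))"
    proof (rule sum_mono)
      fix j assume j: "j \<in> {1..N}"
      have "w j s \<bullet> (rhs x j s - rhs y j s) \<le> norm (w j s) * norm (rhs x j s - rhs y j s)"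
        by (rule norm_cauchy_schwarz)
      also have "\<dots> \<le> norm (w j s) * (\<Sum>k\<in>{1..N}. c * (norm (w j s) + norm (w k s)))"
        using lip[of s j] s j by (intro mult_left_mono) auto
      also have "\<dots> \<le> (\<Sum>k\<in>{1..N}. c * ((3/2) * (norm (w j s))\<^sup>2 + (1/2) * (norm (w k s))\<^sup>2))"
        unfolding sum_distrib_left
      proof (rule sum_mono)
        fix k
        have "norm (w j s) * (norm (w j s) + norm (w k s)) \<le> (3/2) * (norm (w j s))\<^sup>2 + (1/2) * (norm (w k s))\<^sup>2"
          using sum_squares_bound[of "norm (w j s)" "norm (w k s)"] by (simp add: power2_eq_square algebra_simps)
        then have "c * (norm (w j s) * (norm (w j s) + norm (w k s))) \<le> c * ((3/2) * (norm (w j s))\<^sup>2 + (1/2) * (norm (w k s))\<^sup>2)"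
          using c0 by (rule mult_left_mono)
        then show "norm (w j s) * (c * (norm (w j s) + norm (w k s))) \<le> c * ((3/2) * (norm (w j s))\<^sup>2 + (1/2) * (norm (w k s))\<^sup>2)"
          by (simp add: mult_ac)
      qed
      finally show "2 * (w j s \<bullet> (rhs x j s - rhs y j s)) \<le>
          (\<Sum>k\<in>{1..N}. 2 * c * ((3/2) * (norm (w j s))\<^sup>2 + (1/2) * (norm (w k s))\<^sup>2))"
        by (simp add: mult.assoc sum_distrib_left[symmetric])
    qed
    also have "\<dots> = C * E s"
      unfolding E_def C_def
      by (simp add: sum.distrib sum_distrib_left[symmetric] power2_norm_eq_inner algebra_simps)
    finally show "?D \<le> C * E s" .
  qed
  \<comment> \<open>With this integrating factor \<open>F\<close> is nonincreasing and starts at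
    \<open>0\<close>, which forces \<open>E t \<le> 0\<close>.\<close>
  define F where "F s = exp (- (C * s)) * E s" for s
  have "F t \<le> F 0"
  proof (rule DERIV_nonpos_imp_decreasing_open[OF t])
    fix s assume s: "0 < s" "s < t"
    obtain D where D: "(E has_real_derivative D) (at s)" "D \<le> C * E s"
      using E_deriv[of s] s by auto
    have "(F has_real_derivative exp (- (C * s)) * (D - C * E s)) (at s)"
      unfolding F_def by (auto intro!: derivative_eq_intros D simp: algebra_simps)
    moreover have "exp (- (C * s)) * (D - C * E s) \<le> 0"
      using D by (intro mult_nonneg_nonpos) auto
    ultimately show "\<exists>y. (F has_real_derivative y) (at s) \<and> y \<le> 0" by blast
  next
    have "continuous_on {0..t} (w j)" if "j \<in> {1..N}" for j
      unfolding w_def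
      by (intro continuous_intros vortex_solution_continuous_on[OF x that] vortex_solution_continuous_on[OF y that])
    then show "continuous_on {0..t} F"
      unfolding F_def E_def by (intro continuous_intros) auto
  qed
  also have "F 0 = 0"
    using x y unfolding F_def E_def w_def vortex_solution_def by simp
  finally have "E t \<le> 0" by (simp add: F_def mult_le_0_iff)
  moreover have "w j t \<bullet> w j t \<le> E t"
    unfolding E_def by (rule member_le_sum) (use j in auto)
  ultimately have "w j t \<bullet> w j t = 0"
    using inner_ge_zero[of "w j t"] by linarith
  then show ?thesis by (simp add: w_def)
qed

subsection \<open>The velocity field of two rings\<close>

lemma sum_roots_unity_mult:
  fixes f :: "complex \<Rightarrow> 'a::comm_monoid_add"
  assumes "0 < n" "u ^ n = 1"
  shows "(\<Sum>\<zeta> | \<zeta> ^ n = 1. f (u * \<zeta>)) = (\<Sum>\<zeta> | \<zeta> ^ n = 1. f \<zeta>)"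
proof (rule sum.reindex_bij_witness[where i = "\<lambda>\<zeta>. \<zeta> / u" and j = "\<lambda>\<zeta>. u * \<zeta>"])
qed (use assms in \<open>auto simp: power_mult_distrib power_divide zero_power\<close>)

text \<open>Multiplying all roots by a primitive root \<open>u\<close> permutes them, so the sum is
  unchanged, but it is also scaled by \<open>u ^ i\<close>, which differs from
  \<open>1\<close>.\<close>

lemma sum_roots_unity_power:
  assumes "0 < i" "i < n"
  shows "(\<Sum>\<zeta>::complex | \<zeta> ^ n = 1. \<zeta> ^ i) = 0"
proof -
  define u where "u = cis (2 * pi / real n)"
  have n: "0 < n" using assms by simp
  have inj: "inj_on (\<lambda>k. cis (2 * pi * real k / real n)) {..<n}"
    using Complex.bij_betw_roots_unity[OF n] by (rule bij_betw_imp_inj_on)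
  have pw: "u ^ k = cis (2 * pi * real k / real n)" for k
    unfolding u_def Complex.DeMoivre by (simp add: mult_ac)
  have "u ^ i \<noteq> u ^ 0"
    unfolding pw using inj_onD[OF inj, of i 0] assms by fastforce
  moreover have "u ^ n = 1" using n by (simp add: pw)
  then have "(\<Sum>\<zeta> | \<zeta> ^ n = 1. \<zeta> ^ i) = (\<Sum>\<zeta> | \<zeta> ^ n = 1. (u * \<zeta>) ^ i)"
    using sum_roots_unity_mult[OF n, of u "\<lambda>\<zeta>. \<zeta> ^ i"] by simp
  then have "(\<Sum>\<zeta> | \<zeta> ^ n = 1. \<zeta> ^ i) = u ^ i * (\<Sum>\<zeta> | \<zeta> ^ n = 1. \<zeta> ^ i)"
    unfolding power_mult_distrib sum_distrib_left .
  ultimately show ?thesis by simp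
qed

text \<open>The logarithmic derivative of \<open>z ^ n - w ^ n\<close> with respect to
  \<open>z\<close>. Each summand is a polynomial in the root of degree below \<open>n\<close>,
  divided by the common value \<open>z ^ n - w ^ n\<close>; summation over the roots kills every
  power but the zeroth.\<close>

lemma sum_inverse_diff_roots_unity:
  fixes z w :: complex
  assumes n: "0 < n" and zw: "z ^ n \<noteq> w ^ n"
  shows "(\<Sum>\<zeta> | \<zeta> ^ n = 1. 1 / (z - w * \<zeta>)) = of_nat n * z ^ (n - 1) / (z ^ n - w ^ n)"
proof -
  have "1 / (z - w * \<zeta>) = (\<Sum>i<n. z ^ (n - Suc i) * w ^ i * \<zeta> ^ i) / (z ^ n - w ^ n)"
    if "\<zeta> ^ n = 1" for \<zeta>
  proof -
    have "(w * \<zeta>) ^ n - z ^ n = (w * \<zeta> - z) * (\<Sum>i<n. z ^ (n - Suc i) * (w * \<zeta>) ^ i)"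
      by (rule power_diff_sumr2)
    then have "z ^ n - w ^ n = (z - w * \<zeta>) * (\<Sum>i<n. z ^ (n - Suc i) * w ^ i * \<zeta> ^ i)"
      using that by (simp add: power_mult_distrib algebra_simps)
    moreover have "z - w * \<zeta> \<noteq> 0"
      using zw that by (auto simp: power_mult_distrib)
    ultimately show ?thesis using zw by (simp add: field_simps)
  qed
  then have "(\<Sum>\<zeta> | \<zeta> ^ n = 1. 1 / (z - w * \<zeta>)) =
      (\<Sum>\<zeta> | \<zeta> ^ n = 1. \<Sum>i<n. z ^ (n - Suc i) * w ^ i * \<zeta> ^ i) / (z ^ n - w ^ n)"
    by (simp add: sum_divide_distrib)
  also have "(\<Sum>\<zeta> | \<zeta> ^ n = 1. \<Sum>i<n. z ^ (n - Suc i) * w ^ i * \<zeta> ^ i) =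
      (\<Sum>i<n. z ^ (n - Suc i) * w ^ i * (\<Sum>\<zeta> | \<zeta> ^ n = 1. \<zeta> ^ i))"
    by (subst sum.swap) (simp add: sum_distrib_left)
  also have "\<dots> = (\<Sum>i<n. if i = 0 then of_nat n * z ^ (n - 1) else 0)"
    by (intro sum.cong) (auto simp: sum_roots_unity_power card_roots_unity_eq[OF n])
  finally show ?thesis using n by simp
qed

text \<open>The term \<open>\<zeta> = u\<close> contributes \<open>1 / 0 = 0\<close>. Pairing \<open>\<eta>\<close> with \<open>1 / \<eta>\<close> gives
  \<open>1 / (1 - \<eta>) + 1 / (1 - 1 / \<eta>) = 1\<close> for each \<open>\<eta> \<noteq> 1\<close>.\<close>

lemma sum_inverse_diff_roots_unity_self:
  fixes u :: complex
  assumes n: "0 < n" and u: "u ^ n = 1"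
  shows "(\<Sum>\<zeta> | \<zeta> ^ n = 1. 1 / (u - \<zeta>)) = (of_nat n - 1) / (2 * u)"
proof -
  let ?R = "{\<eta>::complex. \<eta> ^ n = 1}"
  have fin: "finite ?R" using card_roots_unity_eq[OF n] n card.infinite by force
  define P where "P = (\<Sum>\<eta>\<in>?R. 1 / (1 - \<eta>))"
  have inv: "P = (\<Sum>\<eta>\<in>?R. 1 / (1 - 1 / \<eta>))"
    unfolding P_def
    by (rule sum.reindex_bij_witness[where i = "\<lambda>\<eta>. 1 / \<eta>" and j = "\<lambda>\<eta>. 1 / \<eta>"])
      (auto simp: power_divide)
  have "2 * P = (\<Sum>\<eta>\<in>?R. 1 / (1 - \<eta>) + 1 / (1 - 1 / \<eta>))"
    using inv by (simp add: sum.distrib P_def)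
  also have "\<dots> = (\<Sum>\<eta>\<in>?R. 1 - (if \<eta> = 1 then 1 else 0))"
  proof (rule sum.cong)
    fix \<eta> :: complex assume "\<eta> \<in> ?R"
    then have "\<eta> \<noteq> 0" using n by (auto simp: zero_power)
    then show "1 / (1 - \<eta>) + 1 / (1 - 1 / \<eta>) = 1 - (if \<eta> = 1 then 1 else 0)"
    proof (cases "\<eta> = 1")
      case False
      have "1 / (1 - \<eta>) + 1 / (1 - 1 / \<eta>) = 1 / (1 - \<eta>) - \<eta> / (1 - \<eta>)"
        using False \<open>\<eta> \<noteq> 0\<close> by (simp add: divide_simps) (simp add: algebra_simps)
      then show ?thesis using False by (simp add: diff_divide_distrib[symmetric])
    qed simp
  qed simp
  also have "\<dots> = of_nat n - 1"
    using fin by (simp add: sum_subtractf card_roots_unity_eq[OF n] sum.delta)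
  finally have P: "P = (of_nat n - 1) / 2" by (simp add: mult.commute)
  have "(\<Sum>\<zeta>\<in>?R. 1 / (u - \<zeta>)) = (\<Sum>\<zeta>\<in>?R. 1 / (u - u * \<zeta>))"
    using sum_roots_unity_mult[OF n u, of "\<lambda>\<zeta>. 1 / (u - \<zeta>)"] by simp
  also have "\<dots> = (\<Sum>\<zeta>\<in>?R. 1 / (1 - \<zeta>) / u)"
    by (intro sum.cong) (simp_all add: algebra_simps)
  also have "\<dots> = P / u" by (simp add: P_def sum_divide_distrib)
  finally show ?thesis by (simp add: P)
qed

section \<open>Ring configurations in complex coordinates\<close>

definition vec2 :: "complex \<Rightarrow> real ^ 2" where
  "vec2 z = vector [Re z, Im z]"

lemma vec2_nth [simp]: "vec2 z $ 1 = Re z" "vec2 z $ 2 = Im z"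
  by (simp_all add: vec2_def)

lemma vec2_diff: "vec2 (z - w) = vec2 z - vec2 w"
  and vec2_add: "vec2 (z + w) = vec2 z + vec2 w"
  and vec2_scaleR: "vec2 (c *\<^sub>R z) = c *\<^sub>R vec2 z"
  and vec2_0: "vec2 0 = 0"
  by (simp_all add: vec_eq_iff forall_2)

lemma vec2_sum: "vec2 (sum f A) = (\<Sum>k\<in>A. vec2 (f k))"
  by (induction A rule: infinite_finite_induct) (simp_all add: vec2_0 vec2_add)

lemma norm_vec2: "norm (vec2 z) = norm z"
  by (simp add: norm_vec_def L2_set_def sum_2 cmod_def)

text \<open>The interaction vector is the conjugate of a reciprocal, so velocities become sums of
  the kind evaluated above. At \<open>z = 0\<close> both sides are \<open>0\<close>, so no case
  distinction is needed for a vortex paired with itself.\<close>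

lemma vec2_inversion: "(c / (norm (vec2 z))\<^sup>2) *\<^sub>R vec2 z = vec2 (c *\<^sub>R cnj (1 / z))"
proof -
  have "cnj (1 / z) = (1 / (norm z)\<^sup>2) *\<^sub>R z"
    using complex_div_cnj[of 1 z] by (simp add: scaleR_conv_of_real)
  then show ?thesis by (simp add: norm_vec2 vec2_scaleR[symmetric])
qed

definition ring_pos :: "nat \<Rightarrow> real \<Rightarrow> real \<Rightarrow> real \<Rightarrow> nat \<Rightarrow> complex" where
  "ring_pos n \<theta>\<^sub>0 r1 r2 j =
     (if j \<in> {1..n} then of_real r1 * cis (theta n \<theta>\<^sub>0 j)
      else if j \<in> {n+1..2*n} then of_real r2 * cis (theta n \<theta>\<^sub>0 (j - n))
      else 0)"

lemma two_rings_eq_vec2: "two_rings n \<theta>\<^sub>0 r1 r2 j = vec2 (ring_pos n \<theta>\<^sub>0 r1 r2 j)"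
  by (simp add: two_rings_def ring_pos_def vec2_0 vec_eq_iff forall_2)

text \<open>The vortices on a ring are counted from \<open>1\<close>, the roots of unity from
  \<open>0\<close>, hence the shift.\<close>

lemma bij_betw_ring:
  assumes "0 < n"
  shows "bij_betw (\<lambda>k. cis (2 * pi * (real k - 1) / real n)) {1..n} {\<zeta>. \<zeta> ^ n = 1}"
proof -
  have "bij_betw (\<lambda>k::nat. k - 1) {1..n} {..<n}"
    by (rule bij_betwI[where g = Suc]) auto
  from bij_betw_trans[OF this Complex.bij_betw_roots_unity[OF assms]]
  show ?thesis
    by (rule bij_betw_cong[THEN iffD1, rotated]) (auto simp: of_nat_diff)
qed

lemma cis_theta: "cis (theta n \<theta>\<^sub>0 k) = cis \<theta>\<^sub>0 * cis (2 * pi * (real k - 1) / real n)"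
  by (simp add: theta_def cis_mult mult_ac add_ac)

lemma sum_ring:
  assumes "0 < n"
  shows "(\<Sum>k\<in>{1..n}. f (cis (theta n \<theta>\<^sub>0 k))) = (\<Sum>\<zeta> | \<zeta> ^ n = 1. f (cis \<theta>\<^sub>0 * \<zeta>))"
  unfolding cis_theta by (rule sum.reindex_bij_betw[OF bij_betw_ring[OF assms]])

text \<open>The radii are quantified inside each case because the same split is applied to the
  positions and to the velocity, where radial speeds take the place of radii.\<close>

lemma ring_pos_cases:
  assumes "j \<in> {1..2*n+1}"
  obtains (inner) k where "k \<in> {1..n}" "j = k" "\<And>r1 r2. ring_pos n \<theta>\<^sub>0 r1 r2 j = of_real r1 * cis (theta n \<theta>\<^sub>0 k)"
  | (outer) k where "k \<in> {1..n}" "j = n + k" "\<And>r1 r2. ring_pos n \<theta>\<^sub>0 r1 r2 j = of_real r2 * cis (theta n \<theta>\<^sub>0 k)"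
  | (origin) "j = 2 * n + 1" "\<And>r1 r2. ring_pos n \<theta>\<^sub>0 r1 r2 j = 0"
proof -
  consider "j \<in> {1..n}" | "j \<in> {n+1..2*n}" | "j = 2*n+1" using assms by force
  then show thesis
  proof cases
    case 1 then show ?thesis by (intro inner[of j]) (auto simp: ring_pos_def)
  next
    case 2 then show ?thesis by (intro outer[of "j - n"]) (auto simp: ring_pos_def)
  next
    case 3 then show ?thesis by (intro origin) (auto simp: ring_pos_def)
  qed
qed

lemma sum_ring_pos:
  assumes n: "0 < n"
  shows "(\<Sum>k\<in>{1..2*n+1}. f (ring_pos n \<theta>\<^sub>0 r1 r2 k)) =
     (\<Sum>\<zeta> | \<zeta> ^ n = 1. f (of_real r1 * (cis \<theta>\<^sub>0 * \<zeta>))) +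
     (\<Sum>\<zeta> | \<zeta> ^ n = 1. f (of_real r2 * (cis \<theta>\<^sub>0 * \<zeta>))) + f 0"
proof -
  have split: "{1..2*n+1} = {1..n} \<union> (+) n ` {1..n} \<union> {2*n+1}"
    by (auto simp: image_iff; presburger)
  have "(\<Sum>k\<in>{1..2*n+1}. f (ring_pos n \<theta>\<^sub>0 r1 r2 k)) =
      (\<Sum>k\<in>{1..n}. f (ring_pos n \<theta>\<^sub>0 r1 r2 k)) + (\<Sum>k\<in>(+) n ` {1..n}. f (ring_pos n \<theta>\<^sub>0 r1 r2 k))
      + f (ring_pos n \<theta>\<^sub>0 r1 r2 (2*n+1))"
    unfolding split
    by (subst sum.union_disjoint, auto)+
  also have "(\<Sum>k\<in>{1..n}. f (ring_pos n \<theta>\<^sub>0 r1 r2 k)) = (\<Sum>k\<in>{1..n}. f (of_real r1 * cis (theta n \<theta>\<^sub>0 k)))"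
    by (intro sum.cong) (auto simp: ring_pos_def)
  also have "\<dots> = (\<Sum>\<zeta> | \<zeta> ^ n = 1. f (of_real r1 * (cis \<theta>\<^sub>0 * \<zeta>)))"
    by (rule sum_ring[OF n])
  also have "(\<Sum>k\<in>(+) n ` {1..n}. f (ring_pos n \<theta>\<^sub>0 r1 r2 k)) = (\<Sum>k\<in>{1..n}. f (of_real r2 * cis (theta n \<theta>\<^sub>0 k)))"
    by (subst sum.reindex) (auto simp: ring_pos_def intro!: sum.cong)
  also have "\<dots> = (\<Sum>\<zeta> | \<zeta> ^ n = 1. f (of_real r2 * (cis \<theta>\<^sub>0 * \<zeta>)))"
    by (rule sum_ring[OF n])
  finally show ?thesis by (simp add: ring_pos_def)
qed

text \<open>The effect of a ring on one of its own points. Here and for the other ring the sum is a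
  real multiple of the reciprocal of the position, so its conjugate is radial.\<close>

lemma ring_sum_self:
  fixes c u :: complex
  assumes n: "0 < n" and u: "u ^ n = 1"
  shows "(\<Sum>\<zeta> | \<zeta> ^ n = 1. 1 / (of_real a * (c * u) - of_real a * (c * \<zeta>))) = 
     (of_nat n - 1) / 2 * (1 / (of_real a * (c * u)))"
proof -
  have "(\<Sum>\<zeta> | \<zeta> ^ n = 1. 1 / (of_real a * (c * u) - of_real a * (c * \<zeta>))) =
      (1 / (of_real a * c)) * (\<Sum>\<zeta> | \<zeta> ^ n = 1. 1 / (u - \<zeta>))"
    unfolding sum_distrib_left
    by (intro sum.cong) (simp_all add: right_diff_distrib[symmetric] mult.assoc)
  then show ?thesis by (simp add: sum_inverse_diff_roots_unity_self[OF n u])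
qed

text \<open>At \<open>z = a * c * u\<close> both \<open>z ^ n\<close> and \<open>(b * c) ^ n\<close>
  are real multiples of \<open>c ^ n\<close>. The common rotation cancels from the logarithmic
  derivative and a real factor remains.\<close>

lemma ring_sum_other:
  fixes c u :: complex
  assumes n: "0 < n" and u: "u ^ n = 1" and c: "c \<noteq> 0" and ab: "a ^ n \<noteq> b ^ n" "a \<noteq> 0"
  shows "(\<Sum>\<zeta> | \<zeta> ^ n = 1. 1 / (of_real a * (c * u) - of_real b * (c * \<zeta>))) = 
     of_real (real n * a ^ n / (a ^ n - b ^ n)) * (1 / (of_real a * (c * u)))"
proof -
  define z where "z = of_real a * (c * u)"
  have u0: "u \<noteq> 0" using u n by (auto simp: zero_power)
  have z0: "z \<noteq> 0" using u0 c ab by (simp add: z_def)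
  have zn: "z ^ n = of_real (a ^ n) * c ^ n" by (simp add: z_def power_mult_distrib u)
  have wn: "(of_real b * c) ^ n = of_real (b ^ n) * c ^ n" by (simp add: power_mult_distrib)
  have d: "z ^ n - (of_real b * c) ^ n = of_real (a ^ n - b ^ n) * c ^ n"
    unfolding zn wn by (simp add: algebra_simps)
  have d0: "of_real (a ^ n - b ^ n) \<noteq> (0::complex)" using ab by (simp only: of_real_eq_0_iff)
  have "(\<Sum>\<zeta> | \<zeta> ^ n = 1. 1 / (z - of_real b * c * \<zeta>)) = of_nat n * z ^ (n - 1) / (z ^ n - (of_real b * c) ^ n)"
  proof (rule sum_inverse_diff_roots_unity[OF n])
    show "z ^ n \<noteq> (of_real b * c) ^ n" using d d0 c by (metis eq_iff_diff_eq_0 mult_eq_0_iff power_not_zero)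
  qed
  also have "z ^ (n - 1) = z ^ n / z" using n z0 by (simp add: power_diff)
  also have "of_nat n * (z ^ n / z) / (z ^ n - (of_real b * c) ^ n) =
     of_real (real n * a ^ n / (a ^ n - b ^ n)) * (1 / z)"
    unfolding d unfolding zn using c d0 z0 by (simp add: divide_simps)
  finally show ?thesis by (simp add: z_def mult.assoc)
qed

text \<open>The velocity is again a two-ring vector, with radial speeds as radii, so the shape is
  preserved. In each speed, twice the sum of \<open>(n-1)/2\<close> from the own ring,
  \<open>1\<close> from the center and the quotient from the other ring gives the numerator. The
  winding numbers enter only through \<open>m\<^sub>0 * m\<^sub>0 = 1\<close>.\<close>

lemma two_rings_velocity:
  assumes n: "2 \<le> n" and j: "j \<in> {1..2*n+1}" and m0: "m\<^sub>0 * m\<^sub>0 = (1::int)"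
    and m: "\<forall>j\<in>{1..2*n+1}. m j = m\<^sub>0" and r: "0 < r1" "r1 < r2"
  shows "(2 * of_int (m j)) *\<^sub>R
     (\<Sum>k\<in>{1..2*n+1} - {j}.
        (of_int (m k) / (norm (two_rings n \<theta>\<^sub>0 r1 r2 j - two_rings n \<theta>\<^sub>0 r1 r2 k))\<^sup>2) *\<^sub>R
          (two_rings n \<theta>\<^sub>0 r1 r2 j - two_rings n \<theta>\<^sub>0 r1 r2 k)) =
     two_rings n \<theta>\<^sub>0 ((real n + 1 + 2 * real n * r1 ^ n / (r1 ^ n - r2 ^ n)) / r1)
       ((real n + 1 + 2 * real n * r2 ^ n / (r2 ^ n - r1 ^ n)) / r2) j" (is "?lhs = two_rings n \<theta>\<^sub>0 ?v1 ?v2 j")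
proof -
  have n0: "0 < n" using n by simp
  define P where "P = ring_pos n \<theta>\<^sub>0 r1 r2"
  have mm: "real_of_int m\<^sub>0 * real_of_int m\<^sub>0 = 1" using m0 by (metis of_int_1 of_int_mult)
  have pw: "r1 ^ n < r2 ^ n" using r n0 by (intro power_strict_mono) auto
  have "?lhs = (2 * of_int m\<^sub>0) *\<^sub>R (\<Sum>k\<in>{1..2*n+1} - {j}. vec2 (of_int m\<^sub>0 *\<^sub>R cnj (1 / (P j - P k))))"
    using j m by (simp add: two_rings_eq_vec2 vec2_diff[symmetric] vec2_inversion P_def)
  \<comment> \<open>The term \<open>k = j\<close> may be added because
    \<open>1 / 0 = 0\<close>.\<close>
  also have "(\<Sum>k\<in>{1..2*n+1} - {j}. vec2 (of_int m\<^sub>0 *\<^sub>R cnj (1 / (P j - P k)))) =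
     (\<Sum>k\<in>{1..2*n+1}. vec2 (of_int m\<^sub>0 *\<^sub>R cnj (1 / (P j - P k))))"
    by (rule sum.mono_neutral_left) (auto simp: vec2_0)
  also have "\<dots> = of_int m\<^sub>0 *\<^sub>R vec2 (cnj (\<Sum>k\<in>{1..2*n+1}. 1 / (P j - P k)))"
    by (simp only: vec2_sum vec2_scaleR cnj_sum scaleR_sum_right)
  also have "(2 * of_int m\<^sub>0) *\<^sub>R \<dots> = 2 *\<^sub>R vec2 (cnj (\<Sum>k\<in>{1..2*n+1}. 1 / (P j - P k)))"
    using mm by (simp only: scaleR_scaleR mult.assoc mult_1_right)
  also have "(\<Sum>k\<in>{1..2*n+1}. 1 / (P j - P k)) =
     (\<Sum>\<zeta> | \<zeta> ^ n = 1. 1 / (P j - of_real r1 * (cis \<theta>\<^sub>0 * \<zeta>))) +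
     (\<Sum>\<zeta> | \<zeta> ^ n = 1. 1 / (P j - of_real r2 * (cis \<theta>\<^sub>0 * \<zeta>))) + 1 / (P j - 0)" (is "_ = ?S")
    unfolding P_def by (rule sum_ring_pos[OF n0])
  finally have lhs: "?lhs = vec2 (2 *\<^sub>R cnj ?S)" by (simp only: vec2_scaleR)
  \<comment> \<open>Stated for radii \<open>a\<close> and \<open>b\<close> in either order, so that
    exchanging the roles serves both rings.\<close>
  have ring: "2 *\<^sub>R cnj ((\<Sum>\<zeta> | \<zeta> ^ n = 1. 1 / (z - of_real a * (cis \<theta>\<^sub>0 * \<zeta>))) +
     (\<Sum>\<zeta> | \<zeta> ^ n = 1. 1 / (z - of_real b * (cis \<theta>\<^sub>0 * \<zeta>))) + 1 / (z - 0)) =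
     of_real ((real n + 1 + 2 * real n * a ^ n / (a ^ n - b ^ n)) / a) * cis (theta n \<theta>\<^sub>0 k)"
    if k: "k \<in> {1..n}" and z: "z = of_real a * cis (theta n \<theta>\<^sub>0 k)" and ab: "a ^ n \<noteq> b ^ n" "a \<noteq> 0" for k z and a b :: real
  proof -
    define u where "u = cis (2 * pi * (real k - 1) / real n)"
    have u: "u ^ n = 1" using bij_betw_apply[OF bij_betw_ring[OF n0] k] by (simp add: u_def)
    have zu: "z = of_real a * (cis \<theta>\<^sub>0 * u)" by (simp add: z cis_theta u_def)
    have self: "(\<Sum>\<zeta> | \<zeta> ^ n = 1. 1 / (z - of_real a * (cis \<theta>\<^sub>0 * \<zeta>))) = of_real ((real n - 1) / 2) * (1 / z)"
      unfolding zu by (subst ring_sum_self[OF n0 u]) simp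
    have other: "(\<Sum>\<zeta> | \<zeta> ^ n = 1. 1 / (z - of_real b * (cis \<theta>\<^sub>0 * \<zeta>))) =
        of_real (real n * a ^ n / (a ^ n - b ^ n)) * (1 / z)"
      unfolding zu by (rule ring_sum_other[OF n0 u]) (use ab in auto)
    have "cnj (1 / z) = cis (theta n \<theta>\<^sub>0 k) / of_real a"
      by (simp add: z cis_cnj divide_complex_def)
    moreover have "of_real ((real n - 1) / 2) * (1 / z) + of_real (real n * a ^ n / (a ^ n - b ^ n)) * (1 / z) + 1 / (z - 0)
       = of_real ((real n - 1) / 2 + real n * a ^ n / (a ^ n - b ^ n) + 1) * (1 / z)"
      by (simp only: of_real_add of_real_1 diff_zero distrib_right mult_1_left)
    ultimately have "2 *\<^sub>R cnj (of_real ((real n - 1) / 2) * (1 / z) + of_real (real n * a ^ n / (a ^ n - b ^ n)) * (1 / z) + 1 / (z - 0))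
      = of_real (2 * ((real n - 1) / 2 + real n * a ^ n / (a ^ n - b ^ n) + 1) / a) * cis (theta n \<theta>\<^sub>0 k)"
      by (simp only: complex_cnj_mult complex_cnj_complex_of_real scaleR_conv_of_real of_real_divide of_real_mult) simp
    also have "2 * ((real n - 1) / 2 + real n * a ^ n / (a ^ n - b ^ n) + 1) = real n + 1 + 2 * real n * a ^ n / (a ^ n - b ^ n)"
      by (simp add: diff_divide_distrib)
    finally show ?thesis unfolding self other .
  qed
  have "2 *\<^sub>R cnj ?S = ring_pos n \<theta>\<^sub>0 ?v1 ?v2 j"
    using j
  proof (cases rule: ring_pos_cases[where \<theta>\<^sub>0 = \<theta>\<^sub>0])
    case (inner k)
    show ?thesis unfolding inner(3)
      by (rule ring[OF inner(1)]) (use pw r inner in \<open>auto simp: P_def\<close>)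
  next
    case (outer k)
    have "2 *\<^sub>R cnj ((\<Sum>\<zeta> | \<zeta> ^ n = 1. 1 / (P j - of_real r2 * (cis \<theta>\<^sub>0 * \<zeta>))) +
       (\<Sum>\<zeta> | \<zeta> ^ n = 1. 1 / (P j - of_real r1 * (cis \<theta>\<^sub>0 * \<zeta>))) + 1 / (P j - 0)) =
       ring_pos n \<theta>\<^sub>0 ?v1 ?v2 j"
      unfolding outer(3)
      by (rule ring[OF outer(1)]) (use pw r outer in \<open>auto simp: P_def\<close>)
    then show ?thesis by (simp only: add.commute add.left_commute)
  next
    case origin
    \<comment> \<open>At the center the numerator contains \<open>0 ^ (n - 1)\<close>, which
      vanishes since \<open>n \<ge> 2\<close>.\<close>
    have "(\<Sum>\<zeta> | \<zeta> ^ n = 1. 1 / (0 - of_real r * (cis \<theta>\<^sub>0 * \<zeta>))) = 0" if "0 < r" for r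
      using sum_inverse_diff_roots_unity[OF n0, of 0 "of_real r * cis \<theta>\<^sub>0"] that n
      by (simp add: zero_power mult.assoc)
    then show ?thesis using r unfolding P_def origin(2) by (simp add: origin)
  qed
  then show ?thesis using lhs by (simp only: two_rings_eq_vec2)
qed

text \<open>For \<open>\<rho> = r^2\<close> the chain rule gives
  \<open>\<rho>' = 2 * r * r'\<close>. The factor \<open>r\<close> cancels the division by the
  radius in the radial speed, which leaves the rates assumed here.\<close>

lemma two_rings_vortex_solution:
  assumes n: "2 \<le> n" and m0: "m\<^sub>0 * m\<^sub>0 = (1::int)" and m: "\<forall>j\<in>{1..2*n+1}. m j = m\<^sub>0"
    and init: "sqrt (\<rho>\<^sub>1 0) = a\<^sub>1" "sqrt (\<rho>\<^sub>2 0) = a\<^sub>2"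
    and cont: "continuous_on {0..} \<rho>\<^sub>1" "continuous_on {0..} \<rho>\<^sub>2"
    and pos: "\<And>t. 0 \<le> t \<Longrightarrow> 0 < \<rho>\<^sub>1 t" and less: "\<And>t. 0 \<le> t \<Longrightarrow> \<rho>\<^sub>1 t < \<rho>\<^sub>2 t"
    and deriv1: "\<And>t. 0 < t \<Longrightarrow> (\<rho>\<^sub>1 has_real_derivative
       2 * (real n + 1 + 2 * real n * sqrt (\<rho>\<^sub>1 t) ^ n / (sqrt (\<rho>\<^sub>1 t) ^ n - sqrt (\<rho>\<^sub>2 t) ^ n))) (at t)"
    and deriv2: "\<And>t. 0 < t \<Longrightarrow> (\<rho>\<^sub>2 has_real_derivative
       2 * (real n + 1 + 2 * real n * sqrt (\<rho>\<^sub>2 t) ^ n / (sqrt (\<rho>\<^sub>2 t) ^ n - sqrt (\<rho>\<^sub>1 t) ^ n))) (at t)"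
  shows "vortex_solution (2*n+1) m (two_rings n \<theta>\<^sub>0 a\<^sub>1 a\<^sub>2)
             (\<lambda>j t. two_rings n \<theta>\<^sub>0 (sqrt (\<rho>\<^sub>1 t)) (sqrt (\<rho>\<^sub>2 t)) j)"
  unfolding vortex_solution_def
proof (intro conjI ballI allI impI)
  show "two_rings n \<theta>\<^sub>0 (sqrt (\<rho>\<^sub>1 0)) (sqrt (\<rho>\<^sub>2 0)) j = two_rings n \<theta>\<^sub>0 a\<^sub>1 a\<^sub>2 j" for j
    by (simp add: init)
  show "continuous_on {0..} (\<lambda>t. two_rings n \<theta>\<^sub>0 (sqrt (\<rho>\<^sub>1 t)) (sqrt (\<rho>\<^sub>2 t)) j)" for j
    by (cases "j \<in> {1..n}"; cases "j \<in> {n+1..2*n}")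
      (simp_all only: two_rings_def if_True if_False, auto intro!: continuous_intros cont)
next
  fix t :: real and j k assume t: "0 \<le> t" and jk: "j \<in> {1..2*n+1}" "k \<in> {1..2*n+1}" "j \<noteq> k"
  have n0: "0 < n" using n by simp
  define r1 r2 where "r1 = sqrt (\<rho>\<^sub>1 t)" "r2 = sqrt (\<rho>\<^sub>2 t)"
  have r: "0 < r1" "r1 < r2" using pos[OF t] less[OF t] by (auto simp: r1_r2_def)
  have inj: "i = i'" if "cis (theta n \<theta>\<^sub>0 i) = cis (theta n \<theta>\<^sub>0 i')" "i \<in> {1..n}" "i' \<in> {1..n}" for i i'
    using inj_onD[OF bij_betw_imp_inj_on[OF bij_betw_ring[OF n0]], of i i'] that
    by (simp only: cis_theta mult_cancel_left) simp
  \<comment> \<open>Separates collisions by modulus and direction: the two rings have different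
    positive radii, and points of one ring have different directions.\<close>
  have polar: "of_real a * cis x = of_real b * cis y \<longleftrightarrow> a = b \<and> cis x = cis y" if "0 < a" "0 < b" for a b x y
  proof
    assume e: "of_real a * cis x = of_real b * cis y"
    then have "cmod (of_real a * cis x) = cmod (of_real b * cis y)" by simp
    then have "a = b" using that by (simp add: norm_mult)
    then show "a = b \<and> cis x = cis y" using e that by simp
  qed auto
  have "ring_pos n \<theta>\<^sub>0 r1 r2 j \<noteq> ring_pos n \<theta>\<^sub>0 r1 r2 k"
    using jk(1)
  proof (cases rule: ring_pos_cases[where \<theta>\<^sub>0 = \<theta>\<^sub>0])
    case (inner i)
    from jk(2) show ?thesis
      by (cases rule: ring_pos_cases[where \<theta>\<^sub>0 = \<theta>\<^sub>0]) (use inner r jk inj in \<open>auto simp: polar\<close>)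
  next
    case (outer i)
    from jk(2) show ?thesis
      by (cases rule: ring_pos_cases[where \<theta>\<^sub>0 = \<theta>\<^sub>0]) (use outer r jk inj in \<open>auto simp: polar\<close>)
  next
    case origin
    from jk(2) show ?thesis
      by (cases rule: ring_pos_cases[where \<theta>\<^sub>0 = \<theta>\<^sub>0]) (use origin r jk in \<open>auto\<close>)
  qed
  then have "ring_pos n \<theta>\<^sub>0 r1 r2 j - ring_pos n \<theta>\<^sub>0 r1 r2 k \<noteq> 0" by simp
  then have "norm (vec2 (ring_pos n \<theta>\<^sub>0 r1 r2 j - ring_pos n \<theta>\<^sub>0 r1 r2 k)) \<noteq> 0"
    by (simp only: norm_vec2 norm_eq_zero) simp
  then show "two_rings n \<theta>\<^sub>0 (sqrt (\<rho>\<^sub>1 t)) (sqrt (\<rho>\<^sub>2 t)) j \<noteq> two_rings n \<theta>\<^sub>0 (sqrt (\<rho>\<^sub>1 t)) (sqrt (\<rho>\<^sub>2 t)) k"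
    by (auto simp: two_rings_eq_vec2 vec2_diff r1_r2_def)
next
  fix t :: real and j assume t: "0 < t" and j: "j \<in> {1..2*n+1}"
  define r1 r2 where "r1 = sqrt (\<rho>\<^sub>1 t)" "r2 = sqrt (\<rho>\<^sub>2 t)"
  have r: "0 < r1" "r1 < r2" using pos[of t] less[of t] t by (auto simp: r1_r2_def)
  have p: "0 < \<rho>\<^sub>1 t" "0 < \<rho>\<^sub>2 t" using pos[of t] less[of t] t by auto
  have dsqrt: "((\<lambda>t. sqrt (f t)) has_real_derivative A / sqrt (f t)) (at t)"
    if "(f has_real_derivative 2 * A) (at t)" "0 < f t" for f :: "real \<Rightarrow> real" and A
    using DERIV_chain2[OF DERIV_real_sqrt[OF that(2)] that(1)]
    by (rule DERIV_cong) (simp add: field_simps)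
  note d1 = dsqrt[OF deriv1[OF t] p(1), folded r1_r2_def]
  note d2 = dsqrt[OF deriv2[OF t] p(2), folded r1_r2_def]
  have dv: "((\<lambda>t. f t *\<^sub>R v) has_vector_derivative (D *\<^sub>R v)) (at t)"
    if "(f has_real_derivative D) (at t)" for f D and v :: "real ^ 2"
    using has_vector_derivative_scaleR[OF that has_vector_derivative_const] by simp
  have "((\<lambda>t. two_rings n \<theta>\<^sub>0 (sqrt (\<rho>\<^sub>1 t)) (sqrt (\<rho>\<^sub>2 t)) j) has_vector_derivative
     two_rings n \<theta>\<^sub>0 ((real n + 1 + 2 * real n * r1 ^ n / (r1 ^ n - r2 ^ n)) / r1)
       ((real n + 1 + 2 * real n * r2 ^ n / (r2 ^ n - r1 ^ n)) / r2) j) (at t)"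
    using dv[OF d1] dv[OF d2]
    by (cases "j \<in> {1..n}"; cases "j \<in> {n+1..2*n}")
      (simp_all only: two_rings_def if_True if_False, simp_all)
  then show "((\<lambda>t. two_rings n \<theta>\<^sub>0 (sqrt (\<rho>\<^sub>1 t)) (sqrt (\<rho>\<^sub>2 t)) j) has_vector_derivative
      (2 * of_int (m j)) *\<^sub>R
     (\<Sum>k\<in>{1..2*n+1} - {j}.
        (of_int (m k) / (norm (two_rings n \<theta>\<^sub>0 (sqrt (\<rho>\<^sub>1 t)) (sqrt (\<rho>\<^sub>2 t)) j - two_rings n \<theta>\<^sub>0 (sqrt (\<rho>\<^sub>1 t)) (sqrt (\<rho>\<^sub>2 t)) k))\<^sup>2) *\<^sub>R
          (two_rings n \<theta>\<^sub>0 (sqrt (\<rho>\<^sub>1 t)) (sqrt (\<rho>\<^sub>2 t)) j - two_rings n \<theta>\<^sub>0 (sqrt (\<rho>\<^sub>1 t)) (sqrt (\<rho>\<^sub>2 t)) k))) (at t)"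
    unfolding r1_r2_def[symmetric] two_rings_velocity[OF n j m0 m r] .
qed

subsection \<open>Dynamics of the squared radii\<close>

text \<open>Putting \<open>\<alpha> = q * \<beta>\<close> and
  \<open>\<alpha> + \<beta> = 8 * n + 4\<close> into the equation for
  \<open>\<beta> - \<alpha>\<close> and clearing denominators yields
  \<open>ring_balance n q = 0\<close>.\<close>

definition ring_balance :: "nat \<Rightarrow> real \<Rightarrow> real" where
  "ring_balance n q = (2 * real n + 1) * (1 - q) * (1 - q powr (real n / 2))
     - real n * (1 + q) * (1 + q powr (real n / 2))"

text \<open>The first product decreases weakly and the second increases strictly. The resulting
  signs on the two sides of the root make it an attractor for the ratio.\<close>

lemma ring_balance_strict_antimono:
  assumes n: "0 < n" and q: "0 \<le> p" "p < q" "q \<le> 1"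
  shows "ring_balance n q < ring_balance n p"
proof -
  define g h where "g = p powr (real n / 2)" "h = q powr (real n / 2)"
  have h: "0 \<le> g" "g \<le> h" "h \<le> 1"
    using n q powr_mono2[of "real n / 2" q 1] by (auto simp: g_h_def intro!: powr_mono2)
  have "(1 - q) * (1 - h) \<le> (1 - p) * (1 - g)" using q h by (intro mult_mono) auto
  then have "(2 * real n + 1) * ((1 - q) * (1 - h)) \<le> (2 * real n + 1) * ((1 - p) * (1 - g))"
    by (rule mult_left_mono) simp
  moreover have "(1 + p) * (1 + g) < (1 + q) * (1 + h)"
    using q h by (intro mult_less_le_imp_less) auto
  then have "real n * ((1 + p) * (1 + g)) < real n * ((1 + q) * (1 + h))"
    using n by simp
  ultimately show ?thesis unfolding ring_balance_def g_h_def mult.assoc by linarith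
qed

lemma ring_balance_root_exists:
  assumes n: "0 < n"
  shows "\<exists>q. 0 < q \<and> q < 1 \<and> ring_balance n q = 0"
proof -
  have "continuous_on {0..1} (ring_balance n)"
    unfolding ring_balance_def using n by (intro continuous_intros continuous_on_powr') auto
  moreover have b: "ring_balance n 0 = real n + 1" "ring_balance n 1 = - 4 * real n"
    using n by (simp_all add: ring_balance_def)
  ultimately obtain q where q: "0 \<le> q" "q \<le> 1" "ring_balance n q = 0"
    using IVT2'[of "ring_balance n" 1 0 0] by auto
  moreover have "q \<noteq> 0" "q \<noteq> 1" using q b n by auto
  ultimately show ?thesis by (intro exI[of _ q]) auto
qed

text \<open>For positive \<open>n\<close> the choice is determined, since strict monotonicity leaves
  only one root.\<close>

definition ring_ratio :: "nat \<Rightarrow> real" where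
  "ring_ratio n = (SOME q. 0 < q \<and> q < 1 \<and> ring_balance n q = 0)"

lemma ring_ratio:
  assumes "0 < n"
  shows "0 < ring_ratio n" "ring_ratio n < 1" "ring_balance n (ring_ratio n) = 0"
  using someI_ex[OF ring_balance_root_exists[OF assms]] by (simp_all add: ring_ratio_def)

text \<open>The balance implies \<open>n * (1 + q) \<le> (2 * n + 1) * (1 - q) \<le> 3 * n * (1 -
  q)\<close>. A bound below \<open>1\<close> uniform in \<open>n\<close> makes
  \<open>q powr (n / 2)\<close> exponentially small.\<close>

lemma ring_ratio_le_half:
  assumes n: "0 < n"
  shows "ring_ratio n \<le> 1 / 2"
proof -
  define q where "q = ring_ratio n"
  define h where "h = q powr (real n / 2)"
  have q: "0 < q" "q < 1" "ring_balance n q = 0" using ring_ratio[OF n] by (auto simp: q_def)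
  have h: "0 \<le> h" by (simp add: h_def)
  have "real n * (1 + q) \<le> real n * (1 + q) * (1 + h)"
    using mult_left_mono[of 1 "1 + h" "real n * (1 + q)"] q h by simp
  also have "\<dots> = (2 * real n + 1) * (1 - q) * (1 - h)"
    using q(3) by (simp add: ring_balance_def h_def)
  also have "\<dots> \<le> (2 * real n + 1) * (1 - q)"
    using mult_left_mono[of "1 - h" 1 "(2 * real n + 1) * (1 - q)"] q h by simp
  also have "\<dots> \<le> real n * (3 * (1 - q))"
  proof -
    have "(2 * real n + 1) * (1 - q) \<le> (3 * real n) * (1 - q)"
      using q n by (intro mult_right_mono) auto
    then show ?thesis by (simp add: mult.assoc mult.left_commute)
  qed
  finally show ?thesis using n by (simp add: q_def)
qed

definition inner_rate :: "nat \<Rightarrow> real" where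
  "inner_rate n = (8 * real n + 4) * ring_ratio n / (1 + ring_ratio n)"

definition outer_rate :: "nat \<Rightarrow> real" where
  "outer_rate n = (8 * real n + 4) / (1 + ring_ratio n)"

text \<open>The fourth claim expresses the gap through the ratio and serves the limit for large
  \<open>n\<close>. The fifth follows from it by expanding the fraction with a power of the outer
  rate.\<close>

lemma ring_rates:
  assumes n: "0 < n"
  shows "0 < inner_rate n" "inner_rate n < outer_rate n"
    "inner_rate n + outer_rate n = 8 * real n + 4"
    "outer_rate n - inner_rate n =
       4 * real n * ((1 + ring_ratio n powr (real n / 2)) / (1 - ring_ratio n powr (real n / 2)))"
    "outer_rate n - inner_rate n = 4 * real n *
       ((outer_rate n powr (real n / 2) + inner_rate n powr (real n / 2)) /
        (outer_rate n powr (real n / 2) - inner_rate n powr (real n / 2)))"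
proof -
  define q where "q = ring_ratio n"
  define h where "h = q powr (real n / 2)"
  have q: "0 < q" "q < 1" "ring_balance n q = 0" using ring_ratio[OF n] by (auto simp: q_def)
  have h: "h < 1" using q n powr_less_mono2[of "real n / 2" q 1] by (simp add: h_def)
  have a: "inner_rate n = q * outer_rate n" by (simp add: inner_rate_def outer_rate_def q_def)
  have b: "outer_rate n = (8 * real n + 4) / (1 + q)" by (simp add: outer_rate_def q_def)
  have b0: "0 < outer_rate n" using q by (simp add: b)
  show "0 < inner_rate n" "inner_rate n < outer_rate n" using a q b0 by auto
  have sum: "(1 + q) * outer_rate n = 8 * real n + 4" using q by (simp add: b)
  then show "inner_rate n + outer_rate n = 8 * real n + 4" by (simp add: a algebra_simps)
  have "(outer_rate n - inner_rate n) * ((1 + q) * (1 - h)) = ((1 + q) * outer_rate n) * ((1 - q) * (1 - h))"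
    by (simp add: a algebra_simps)
  also have "\<dots> = 4 * ((2 * real n + 1) * (1 - q) * (1 - h))"
    by (simp add: sum)
  also have "\<dots> = 4 * (real n * (1 + q) * (1 + h))"
    using q(3) by (simp add: ring_balance_def h_def)
  finally have "outer_rate n - inner_rate n = 4 * (real n * (1 + q) * (1 + h)) / ((1 + q) * (1 - h))"
    using q h by (simp add: eq_divide_eq)
  then have d: "outer_rate n - inner_rate n = 4 * real n * ((1 + h) / (1 - h))"
    using q by simp
  then show "outer_rate n - inner_rate n =
       4 * real n * ((1 + ring_ratio n powr (real n / 2)) / (1 - ring_ratio n powr (real n / 2)))"
    by (simp add: h_def q_def)
  define B where "B = outer_rate n powr (real n / 2)"
  have B: "0 < B" using b0 by (simp add: B_def)
  have "inner_rate n powr (real n / 2) = h * B"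
    using q b0 by (simp add: a h_def B_def powr_mult)
  moreover have "(B + h * B) / (B - h * B) = (1 + h) / (1 - h)"
  proof -
    have "(B + h * B) / (B - h * B) = (B * (1 + h)) / (B * (1 - h))" by (simp add: algebra_simps)
    then show ?thesis using B by simp
  qed
  ultimately show "outer_rate n - inner_rate n = 4 * real n *
       ((outer_rate n powr (real n / 2) + inner_rate n powr (real n / 2)) /
        (outer_rate n powr (real n / 2) - inner_rate n powr (real n / 2)))"
    using d by (simp add: B_def)
qed

text \<open>Adding sum and difference of the rates shows that the outer one exceeds
  \<open>6 * n + 2\<close> by exactly \<open>4 * n * h / (1 - h)\<close>, where
  \<open>h = q powr (n / 2)\<close> is at most \<open>(1/2) powr (n / 2)\<close>. As the sum is
  \<open>8 * n + 4\<close>, the inner error is the opposite.\<close>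

lemma ring_rates_limit:
  "(\<lambda>n. inner_rate n - (2 * real n + 2)) \<longlonglongrightarrow> 0"
  "(\<lambda>n. outer_rate n - (6 * real n + 2)) \<longlonglongrightarrow> 0"
proof -
  define e where "e n = outer_rate n - (6 * real n + 2)" for n
  have e: "0 \<le> e n \<and> e n \<le> 4 * real n * ((1/2) powr (real n / 2) / (1 - (1/2) powr (real n / 2)))"
    if n: "0 < n" for n
  proof -
    define h k where "h = ring_ratio n powr (real n / 2)" "k = (1/2::real) powr (real n / 2)"
    have h: "0 \<le> h" "h \<le> k"
      using ring_ratio[OF n] ring_ratio_le_half[OF n] n by (auto simp: h_k_def intro!: powr_mono2)
    have k: "k < 1" using n powr_less_mono2[of "real n / 2" "1/2" 1] by (simp add: h_k_def)
    have "2 * e n = (inner_rate n + outer_rate n) + (outer_rate n - inner_rate n) - (12 * real n + 4)"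
      by (simp add: e_def)
    also have "\<dots> = 4 * real n * ((1 + h) / (1 - h)) - 4 * real n"
      unfolding ring_rates(3)[OF n] ring_rates(4)[OF n] by (simp add: h_k_def)
    also have "\<dots> = 2 * (4 * real n * (h / (1 - h)))"
      using h k by (simp add: field_simps)
    finally have "e n = 4 * real n * (h / (1 - h))" by simp
    moreover have "h / (1 - h) \<le> k / (1 - k)" using h k by (intro frac_le) auto
    then have "4 * real n * (h / (1 - h)) \<le> 4 * real n * (k / (1 - k))"
      by (rule mult_left_mono) simp
    moreover have "0 \<le> 4 * real n * (h / (1 - h))" using h k by simp
    ultimately show ?thesis by (simp only: h_k_def)
  qed
  have "e \<longlonglongrightarrow> 0"
  proof (rule tendsto_sandwich[OF _ _ tendsto_const])
    show "(\<lambda>n. 4 * real n * ((1/2) powr (real n / 2) / (1 - (1/2) powr (real n / 2)))) \<longlonglongrightarrow> 0"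
      by real_asymp
    show "\<forall>\<^sub>F n in sequentially. 0 \<le> e n"
      using eventually_gt_at_top[of 0] by eventually_elim (use e in blast)
    show "\<forall>\<^sub>F n in sequentially. e n \<le> 4 * real n * ((1/2) powr (real n / 2) / (1 - (1/2) powr (real n / 2)))"
      using eventually_gt_at_top[of 0] by eventually_elim (use e in blast)
  qed
  then show "(\<lambda>n. outer_rate n - (6 * real n + 2)) \<longlonglongrightarrow> 0" unfolding e_def[abs_def] .
  have "(\<lambda>n. - e n) \<longlonglongrightarrow> 0" using tendsto_minus[OF \<open>e \<longlonglongrightarrow> 0\<close>] by simp
  then show "(\<lambda>n. inner_rate n - (2 * real n + 2)) \<longlonglongrightarrow> 0"
  proof (rule Lim_transform_eventually)
    show "\<forall>\<^sub>F n in sequentially. - e n = inner_rate n - (2 * real n + 2)"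
      using eventually_gt_at_top[of 0]
    proof eventually_elim
      case (elim n)
      show ?case using ring_rates(3)[OF elim] by (simp add: e_def)
    qed
  qed
qed

section \<open>Global solutions for the squared radii\<close>

text \<open>The rates of the squared radii are invariant under scaling, hence functions of their
  ratio \<open>q\<close> alone; this makes the equation for \<open>q\<close> autonomous.\<close>

lemma sqrt_power_ratio:
  assumes "0 < q" "0 < s"
  shows "sqrt (q * s) ^ n / (sqrt (q * s) ^ n - sqrt s ^ n) = q powr (real n / 2) / (q powr (real n / 2) - 1)"
    and "sqrt s ^ n / (sqrt s ^ n - sqrt (q * s) ^ n) = 1 / (1 - q powr (real n / 2))"
proof -
  define h where "h = sqrt q ^ n"
  have "h = (q powr (1 / 2)) powr real n"
    using assms by (simp add: h_def powr_half_sqrt powr_realpow)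
  then have h: "q powr (real n / 2) = h" by (simp add: powr_powr)
  define s' where "s' = sqrt s ^ n"
  have s': "0 < s'" using assms by (simp add: s'_def)
  have qs: "sqrt (q * s) ^ n = s' * h" by (simp add: real_sqrt_mult power_mult_distrib h_def s'_def)
  have 1: "s' * h - s' = s' * (h - 1)" "s' - s' * h = s' * (1 - h)" by (simp_all add: algebra_simps)
  show "sqrt (q * s) ^ n / (sqrt (q * s) ^ n - sqrt s ^ n) = q powr (real n / 2) / (q powr (real n / 2) - 1)"
    "sqrt s ^ n / (sqrt s ^ n - sqrt (q * s) ^ n) = 1 / (1 - q powr (real n / 2))"
    unfolding h qs s'_def[symmetric] 1 using s' by simp_all
qed

text \<open>Summing the equations for \<open>\<rho>\<^sub>1\<close> and \<open>\<rho>\<^sub>2\<close> gives \<open>\<rho>\<^sub>1 + \<rho>\<^sub>2 = A\<^sub>1 + A\<^sub>2 + (8 n + 4) t\<close>. In the time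
  \<open>\<tau> = ln (\<rho>\<^sub>1 + \<rho>\<^sub>2)\<close> (up to a constant) the ratio \<open>q = \<rho>\<^sub>1 / \<rho>\<^sub>2\<close> obeys an autonomous equation whose
  right-hand side has the sign of \<open>ring_balance n q\<close>.\<close>

lemma ring_dynamics:
  fixes A\<^sub>1 A\<^sub>2 :: real
  assumes n: "0 < n" and A: "0 < A\<^sub>1" "A\<^sub>1 < A\<^sub>2"
  obtains \<rho>\<^sub>1 \<rho>\<^sub>2 :: "real \<Rightarrow> real" where
    "\<rho>\<^sub>1 0 = A\<^sub>1" "\<rho>\<^sub>2 0 = A\<^sub>2" "continuous_on {0..} \<rho>\<^sub>1" "continuous_on {0..} \<rho>\<^sub>2"
    "\<And>t. 0 \<le> t \<Longrightarrow> 0 < \<rho>\<^sub>1 t" "\<And>t. 0 \<le> t \<Longrightarrow> \<rho>\<^sub>1 t < \<rho>\<^sub>2 t"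
    "\<And>t. 0 < t \<Longrightarrow> (\<rho>\<^sub>1 has_real_derivative
       2 * (real n + 1 + 2 * real n * sqrt (\<rho>\<^sub>1 t) ^ n / (sqrt (\<rho>\<^sub>1 t) ^ n - sqrt (\<rho>\<^sub>2 t) ^ n))) (at t)"
    "\<And>t. 0 < t \<Longrightarrow> (\<rho>\<^sub>2 has_real_derivative
       2 * (real n + 1 + 2 * real n * sqrt (\<rho>\<^sub>2 t) ^ n / (sqrt (\<rho>\<^sub>2 t) ^ n - sqrt (\<rho>\<^sub>1 t) ^ n))) (at t)"
    "\<rho>\<^sub>1 \<sim>[at_top] (\<lambda>t. inner_rate n * t)" "\<rho>\<^sub>2 \<sim>[at_top] (\<lambda>t. outer_rate n * t)"
proof -
  define a b where "a = A\<^sub>1 / A\<^sub>2" "b = ring_ratio n"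
  \<comment> \<open>With \<open>S = \<rho>\<^sub>1 + \<rho>\<^sub>2\<close>, this is \<open>q' =
    (\<rho>\<^sub>1' - q * \<rho>\<^sub>2') / \<rho>\<^sub>2\<close>, where
    \<open>\<rho>\<^sub>2 = S / (1 + q)\<close>, divided by the speed \<open>(8 * n + 4) / S\<close>
    of the logarithmic time.\<close>
  define f where "f q = (1 + q) * ring_balance n q / ((4 * real n + 2) * (1 - q powr (real n / 2)))" for q
  have a: "0 < a" "a < 1" using A by (auto simp: a_b_def)
  have b: "0 < b" "b < 1" "ring_balance n b = 0" using ring_ratio[OF n] by (auto simp: a_b_def)
  have seg: "0 < q" "q < 1" if "q \<in> closed_segment a b" for q
    using that a b by (auto simp: closed_segment_eq_real_ivl split: if_splits)
  have h1: "q powr (real n / 2) < 1" if "0 < q" "q < 1" for q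
    using that n powr_less_mono2[of "real n / 2" q 1] by simp
  have "continuous_on (closed_segment a b) f"
    unfolding f_def ring_balance_def
    by (intro continuous_intros) (use seg h1 in \<open>force+\<close>)
  moreover have "0 < f q * (b - q)" if "q \<in> closed_segment a b" "q \<noteq> b" for q
  proof -
    note q = seg[OF that(1)]
    have "0 < ring_balance n q * (b - q)"
    proof (cases "q < b")
      case True
      then show ?thesis using ring_balance_strict_antimono[OF n, of q b] q b by simp
    next
      case False
      then show ?thesis using ring_balance_strict_antimono[OF n, of b q] q b that
        by (simp add: mult_neg_neg)
    qed
    moreover have "f q * (b - q) = (1 + q) / ((4 * real n + 2) * (1 - q powr (real n / 2))) * (ring_balance n q * (b - q))"
      by (simp add: f_def)
    moreover have "0 < (1 + q) / ((4 * real n + 2) * (1 - q powr (real n / 2)))"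
      using q h1[OF q] by (intro divide_pos_pos mult_pos_pos) auto
    ultimately show ?thesis by (simp only: mult_pos_pos)
  qed
  moreover have "f b = 0" by (simp add: f_def b)
  moreover have "f differentiable (at b)"
  proof -
    have "(\<lambda>q. q powr (real n / 2)) differentiable (at b)"
      using has_real_derivative_powr[OF b(1)] real_differentiable_def by blast
    then show ?thesis
      unfolding f_def ring_balance_def using h1[OF b(1,2)] n by (intro derivative_intros) auto
  qed
  then have "\<exists>f'. (f has_real_derivative f') (at b)" by (simp add: real_differentiable_def)
  ultimately obtain y where y: "y 0 = a" "continuous_on {0..} y"
    "\<And>t. 0 \<le> t \<Longrightarrow> y t \<in> closed_segment a b"
    "\<And>t. 0 < t \<Longrightarrow> (y has_real_derivative f (y t)) (at t)" "(y \<longlongrightarrow> b) at_top"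
    using attracting_flow[of a b f] by metis
  define S where "S t = A\<^sub>1 + A\<^sub>2 + (8 * real n + 4) * t" for t
  define \<tau> where "\<tau> t = ln (S t) - ln (A\<^sub>1 + A\<^sub>2)" for t
  define q where "q t = y (\<tau> t)" for t
  have S0: "A\<^sub>1 + A\<^sub>2 \<le> S t" if "0 \<le> t" for t using that by (simp add: S_def)
  have S: "0 < S t" if "0 \<le> t" for t using S0[OF that] A by simp
  have \<tau>0: "0 \<le> \<tau> t" if "0 \<le> t" for t using S0[OF that] A by (simp add: \<tau>_def)
  have \<tau>1: "0 < \<tau> t" if "0 < t" for t
  proof -
    have "A\<^sub>1 + A\<^sub>2 < S t" using that by (simp add: S_def)
    then show ?thesis using A by (simp add: \<tau>_def)
  qed
  have q01: "0 < q t" "q t < 1" if "0 \<le> t" for t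
    using seg[OF y(3)[OF \<tau>0[OF that]]] by (auto simp: q_def)
  have S_cont: "continuous_on {0..} S" unfolding S_def by (intro continuous_intros)
  have "continuous_on {0..} \<tau>"
    unfolding \<tau>_def using S A by (intro continuous_intros S_cont) force+
  then have q_cont: "continuous_on {0..} q"
    unfolding q_def by (rule continuous_on_compose2[OF y(2)]) (use \<tau>0 in auto)
  have S_deriv: "(S has_real_derivative 8 * real n + 4) (at t)" for t
    unfolding S_def by (auto intro!: derivative_eq_intros)
  have q_deriv: "(q has_real_derivative f (q t) * ((8 * real n + 4) / S t)) (at t)" if t: "0 < t" for t
  proof -
    have "(\<tau> has_real_derivative (8 * real n + 4) / S t) (at t)"
      unfolding \<tau>_def using S[of t] t A
      by (auto intro!: derivative_eq_intros S_deriv)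
    from DERIV_chain2[where f = y and g = \<tau>, OF y(4)[OF \<tau>1[OF t]] this] show ?thesis
      by (simp only: q_def[abs_def])
  qed
  \<comment> \<open>The squared radii are recovered from their known sum \<open>S\<close> and their
    ratio \<open>q\<close>.\<close>
  define \<rho>\<^sub>2 where "\<rho>\<^sub>2 t = S t / (1 + q t)" for t
  define \<rho>\<^sub>1 where "\<rho>\<^sub>1 t = q t * \<rho>\<^sub>2 t" for t
  have \<rho>2: "0 < \<rho>\<^sub>2 t" if "0 \<le> t" for t using q01[OF that] S[OF that] by (simp add: \<rho>\<^sub>2_def)
  have q_lim: "(q \<longlongrightarrow> b) at_top"
  proof -
    have "filterlim \<tau> at_top at_top"
      unfolding \<tau>_def S_def using A n by real_asymp
    then show ?thesis unfolding q_def by (rule filterlim_compose[OF y(5)])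
  qed
  \<comment> \<open>Translates back: the left sides are the derivatives of
    \<open>S / (1 + q)\<close> and of its product with \<open>q\<close>, the right sides the
    required rates in terms of the ratio.\<close>
  have key: "(8 * real n + 4 - (8 * real n + 4) * f x / (1 + x)) / (1 + x) =
      2 * (real n + 1 + 2 * real n * (1 / (1 - x powr (real n / 2))))"
    "(8 * real n + 4 + (8 * real n + 4) * f x / (1 + x) / x) * x / (1 + x) =
      2 * (real n + 1 + 2 * real n * (x powr (real n / 2) / (x powr (real n / 2) - 1)))" if x: "0 < x" "x < 1" for x
  proof -
    define h where "h = x powr (real n / 2)"
    have h: "h < 1" using h1[OF x] by (simp add: h_def)
    have "(8 * real n + 4) * f x / (1 + x) = 2 * ring_balance n x / (1 - h)"
    proof -
      define K where "K = 4 * real n + 2"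
      have "K \<noteq> 0" "8 * real n + 4 = 2 * K" by (simp_all add: K_def)
      moreover have "f x = (1 + x) * ring_balance n x / (K * (1 - h))"
        by (simp add: f_def h_def K_def)
      moreover have "1 + x \<noteq> 0" using x by simp
      ultimately show ?thesis by simp
    qed
    moreover have "1 - h \<noteq> 0" "h - 1 \<noteq> 0" "1 + x \<noteq> 0" "x \<noteq> 0" using h x by auto
    ultimately show "(8 * real n + 4 - (8 * real n + 4) * f x / (1 + x)) / (1 + x) =
      2 * (real n + 1 + 2 * real n * (1 / (1 - x powr (real n / 2))))"
      "(8 * real n + 4 + (8 * real n + 4) * f x / (1 + x) / x) * x / (1 + x) =
      2 * (real n + 1 + 2 * real n * (x powr (real n / 2) / (x powr (real n / 2) - 1)))"
      unfolding h_def[symmetric]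
      by (simp_all add: ring_balance_def h_def[symmetric] divide_simps) (simp_all add: algebra_simps)
  qed
  have \<rho>_deriv: "(\<rho>\<^sub>2 has_real_derivative (8 * real n + 4 - (8 * real n + 4) * f (q t) / (1 + q t)) / (1 + q t)) (at t)"
    "(\<rho>\<^sub>1 has_real_derivative (8 * real n + 4 + (8 * real n + 4) * f (q t) / (1 + q t) / q t) * q t / (1 + q t)) (at t)"
    if t: "0 < t" for t
  proof -
    have p: "q t \<noteq> 0" "1 + q t \<noteq> 0" "S t \<noteq> 0" using q01[of t] S[of t] t by auto
    have D2_eq: "(c * (1 + r) - s * (F * (c / s))) / ((1 + r) * (1 + r)) = (c - c * F / (1 + r)) / (1 + r)"
      if "1 + r \<noteq> 0" "s \<noteq> 0" for c r s F :: real
      using that by (simp add: divide_simps, (simp add: algebra_simps)?)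
    have D1_eq: "F * (c / s) * (s / (1 + r)) + (c - c * F / (1 + r)) / (1 + r) * r = (c + c * F / (1 + r) / r) * r / (1 + r)"
      if "1 + r \<noteq> 0" "s \<noteq> 0" "r \<noteq> 0" for c r s F :: real
      using that by (simp add: divide_simps, (simp add: algebra_simps)?)
    have "((\<lambda>t. 1 + q t) has_real_derivative f (q t) * ((8 * real n + 4) / S t)) (at t)"
      using DERIV_add[OF DERIV_const q_deriv[OF t]] by simp
    from DERIV_divide[OF S_deriv this p(2)]
    show D2: "(\<rho>\<^sub>2 has_real_derivative (8 * real n + 4 - (8 * real n + 4) * f (q t) / (1 + q t)) / (1 + q t)) (at t)"
      unfolding D2_eq[OF p(2,3)] \<rho>\<^sub>2_def[abs_def] .
    from DERIV_mult[OF q_deriv[OF t] this]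
    show "(\<rho>\<^sub>1 has_real_derivative (8 * real n + 4 + (8 * real n + 4) * f (q t) / (1 + q t) / q t) * q t / (1 + q t)) (at t)"
      unfolding \<rho>\<^sub>1_def[abs_def] by (rule DERIV_cong) (simp only: \<rho>\<^sub>2_def D1_eq[OF p(2,3,1)])
  qed
  have S_asymp: "((\<lambda>t. S t / ((8 * real n + 4) * t)) \<longlongrightarrow> 1) at_top"
    unfolding S_def using A n by real_asymp
  have \<rho>2_asymp: "\<rho>\<^sub>2 \<sim>[at_top] (\<lambda>t. outer_rate n * t)"
  proof (rule asymp_equivI')
    have "((\<lambda>t. S t / ((8 * real n + 4) * t) * ((1 + b) / (1 + q t))) \<longlongrightarrow> 1 * ((1 + b) / (1 + b))) at_top"
      using b by (intro tendsto_intros S_asymp q_lim) auto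
    moreover have "\<rho>\<^sub>2 t / (outer_rate n * t) = S t / ((8 * real n + 4) * t) * ((1 + b) / (1 + q t))" for t
      by (simp add: \<rho>\<^sub>2_def outer_rate_def a_b_def mult_ac)
    ultimately show "((\<lambda>t. \<rho>\<^sub>2 t / (outer_rate n * t)) \<longlongrightarrow> 1) at_top" using b by simp
  qed
  have "q \<sim>[at_top] (\<lambda>_. b)"
    using q_lim b by (intro asymp_equivI') (auto intro!: tendsto_eq_intros)
  from asymp_equiv_mult[OF this \<rho>2_asymp]
  have \<rho>1_asymp: "\<rho>\<^sub>1 \<sim>[at_top] (\<lambda>t. inner_rate n * t)"
    by (simp add: \<rho>\<^sub>1_def[abs_def] inner_rate_def outer_rate_def a_b_def mult_ac)
  show thesis
  proof (rule that[of \<rho>\<^sub>1 \<rho>\<^sub>2])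
    have q0: "q 0 = A\<^sub>1 / A\<^sub>2" using A y(1) by (simp add: q_def \<tau>_def S_def a_b_def)
    show r2: "\<rho>\<^sub>2 0 = A\<^sub>2" using A by (simp add: \<rho>\<^sub>2_def q0 S_def divide_simps)
    show "\<rho>\<^sub>1 0 = A\<^sub>1" using A by (simp add: \<rho>\<^sub>1_def q0 r2)
    show c2: "continuous_on {0..} \<rho>\<^sub>2"
      unfolding \<rho>\<^sub>2_def using q01 by (intro continuous_intros S_cont q_cont) force
    show "continuous_on {0..} \<rho>\<^sub>1"
      unfolding \<rho>\<^sub>1_def by (intro continuous_intros c2 q_cont)
    show "0 < \<rho>\<^sub>1 t" "\<rho>\<^sub>1 t < \<rho>\<^sub>2 t" if "0 \<le> t" for t
      using q01[OF that] \<rho>2[OF that] by (simp_all add: \<rho>\<^sub>1_def)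
    show "(\<rho>\<^sub>1 has_real_derivative
       2 * (real n + 1 + 2 * real n * sqrt (\<rho>\<^sub>1 t) ^ n / (sqrt (\<rho>\<^sub>1 t) ^ n - sqrt (\<rho>\<^sub>2 t) ^ n))) (at t)"
      if t: "0 < t" for t
      using \<rho>_deriv(2)[OF t] key(2)[of "q t"] q01[of t] \<rho>2[of t] t sqrt_power_ratio(1)[of "q t" "\<rho>\<^sub>2 t" n]
      by (simp only: \<rho>\<^sub>1_def[symmetric] times_divide_eq_right[symmetric])
    show "(\<rho>\<^sub>2 has_real_derivative
       2 * (real n + 1 + 2 * real n * sqrt (\<rho>\<^sub>2 t) ^ n / (sqrt (\<rho>\<^sub>2 t) ^ n - sqrt (\<rho>\<^sub>1 t) ^ n))) (at t)"
      if t: "0 < t" for t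
      using \<rho>_deriv(1)[OF t] key(1)[of "q t"] q01[of t] \<rho>2[of t] t sqrt_power_ratio(2)[of "q t" "\<rho>\<^sub>2 t" n]
      by (simp only: \<rho>\<^sub>1_def[symmetric] times_divide_eq_right[symmetric])
  qed (rule \<rho>1_asymp \<rho>2_asymp)+
qed

text \<open>For \<open>n = 2\<close> the gap \<open>d = \<rho>\<^sub>2 - \<rho>\<^sub>1\<close>
  satisfies \<open>d * d' = 8 * (\<rho>\<^sub>1 + \<rho>\<^sub>2)\<close> with the sum
  \<open>2 * C\<^sub>1 + 20 * t\<close>. Integration gives \<open>d^2 / 4\<close> as the radicand;
  the proof checks the formulas by differentiation.\<close>

lemma ring_dynamics_two:
  fixes a\<^sub>1 a\<^sub>2 C\<^sub>1 C\<^sub>2 :: real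
  assumes a: "0 < a\<^sub>1" "a\<^sub>1 < a\<^sub>2" and C: "C\<^sub>1 = (a\<^sub>1\<^sup>2 + a\<^sub>2\<^sup>2) / 2" "C\<^sub>2 = (a\<^sub>2\<^sup>2 - a\<^sub>1\<^sup>2) / 2"
  defines "\<rho>\<^sub>1 \<equiv> \<lambda>t. C\<^sub>1 + 10 * t - sqrt (C\<^sub>2\<^sup>2 + 8 * C\<^sub>1 * t + 40 * t\<^sup>2)"
    and "\<rho>\<^sub>2 \<equiv> \<lambda>t. C\<^sub>1 + 10 * t + sqrt (C\<^sub>2\<^sup>2 + 8 * C\<^sub>1 * t + 40 * t\<^sup>2)"
  shows "sqrt (\<rho>\<^sub>1 0) = a\<^sub>1" "sqrt (\<rho>\<^sub>2 0) = a\<^sub>2"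
    "continuous_on {0..} \<rho>\<^sub>1" "continuous_on {0..} \<rho>\<^sub>2"
    "\<And>t. 0 \<le> t \<Longrightarrow> 0 < \<rho>\<^sub>1 t" "\<And>t. 0 \<le> t \<Longrightarrow> \<rho>\<^sub>1 t < \<rho>\<^sub>2 t"
    "\<And>t. 0 < t \<Longrightarrow> (\<rho>\<^sub>1 has_real_derivative
       2 * (real 2 + 1 + 2 * real 2 * sqrt (\<rho>\<^sub>1 t) ^ 2 / (sqrt (\<rho>\<^sub>1 t) ^ 2 - sqrt (\<rho>\<^sub>2 t) ^ 2))) (at t)"
    "\<And>t. 0 < t \<Longrightarrow> (\<rho>\<^sub>2 has_real_derivative
       2 * (real 2 + 1 + 2 * real 2 * sqrt (\<rho>\<^sub>2 t) ^ 2 / (sqrt (\<rho>\<^sub>2 t) ^ 2 - sqrt (\<rho>\<^sub>1 t) ^ 2))) (at t)"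
proof -
  define R where "R t = C\<^sub>2\<^sup>2 + 8 * C\<^sub>1 * t + 40 * t\<^sup>2" for t
  have sq: "a\<^sub>1\<^sup>2 < a\<^sub>2\<^sup>2" using a by (intro power_strict_mono) auto
  have "0 < C\<^sub>2" using sq by (simp add: C)
  moreover have "C\<^sub>2 < C\<^sub>1" using a by (simp add: C)
  ultimately have C0: "0 < C\<^sub>2" "C\<^sub>2 < C\<^sub>1" "0 < C\<^sub>1" by simp_all
  have R: "0 < R t" if "0 \<le> t" for t
    using that C0 by (auto simp: R_def intro!: add_pos_nonneg)
  show "sqrt (\<rho>\<^sub>1 0) = a\<^sub>1" "sqrt (\<rho>\<^sub>2 0) = a\<^sub>2"
    using C0 a by (simp_all add: \<rho>\<^sub>1_def \<rho>\<^sub>2_def) (simp_all add: C field_simps)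
  show "continuous_on {0..} \<rho>\<^sub>1" "continuous_on {0..} \<rho>\<^sub>2"
    unfolding \<rho>\<^sub>1_def \<rho>\<^sub>2_def by (intro continuous_intros)+
  show pos: "0 < \<rho>\<^sub>1 t" if t: "0 \<le> t" for t
  proof -
    \<comment> \<open>Compares the radicand with \<open>(C\<^sub>1 + 10 * t)^2\<close> coefficient
      by coefficient.\<close>
    have "C\<^sub>2\<^sup>2 < C\<^sub>1\<^sup>2" using C0 by (intro power_strict_mono) auto
    moreover have "0 \<le> C\<^sub>1 * t" using C0 t by simp
    ultimately have "R t < (C\<^sub>1 + 10 * t)\<^sup>2"
      by (simp add: R_def power2_sum power_mult_distrib) (use zero_le_power2[of t] in linarith)
    then have "sqrt (R t) < C\<^sub>1 + 10 * t" using C0 t by (intro real_less_lsqrt) auto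
    then show ?thesis using C0 t by (simp add: \<rho>\<^sub>1_def R_def)
  qed
  show less: "\<rho>\<^sub>1 t < \<rho>\<^sub>2 t" if t: "0 \<le> t" for t
    using R[OF t] by (simp add: \<rho>\<^sub>1_def \<rho>\<^sub>2_def R_def)
  fix t :: real assume t: "0 < t"
  define Q where "Q = sqrt (R t)"
  have Q: "0 < Q" using R[of t] t by (simp add: Q_def)
  have DR: "((\<lambda>t. sqrt (R t)) has_real_derivative 4 * (C\<^sub>1 + 10 * t) / Q) (at t)"
  proof -
    have "(R has_real_derivative 8 * C\<^sub>1 + 80 * t) (at t)"
      unfolding R_def by (auto intro!: derivative_eq_intros)
    from DERIV_chain2[OF DERIV_real_sqrt this] R[of t] t
    have "((\<lambda>t. sqrt (R t)) has_real_derivative inverse (sqrt (R t)) / 2 * (8 * C\<^sub>1 + 80 * t)) (at t)"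
      by simp
    then show ?thesis by (rule DERIV_cong) (use Q in \<open>simp add: Q_def[symmetric] field_simps\<close>)
  qed
  have lin: "((\<lambda>t. C\<^sub>1 + 10 * t) has_real_derivative 10) (at t)"
    by (auto intro!: derivative_eq_intros)
  have r: "\<rho>\<^sub>1 t = C\<^sub>1 + 10 * t - Q" "\<rho>\<^sub>2 t = C\<^sub>1 + 10 * t + Q"
    by (simp_all add: \<rho>\<^sub>1_def \<rho>\<^sub>2_def Q_def R_def)
  have s: "sqrt (\<rho>\<^sub>1 t) ^ 2 = \<rho>\<^sub>1 t" "sqrt (\<rho>\<^sub>2 t) ^ 2 = \<rho>\<^sub>2 t"
    using pos[of t] less[of t] t by auto
  have "(\<rho>\<^sub>1 has_real_derivative 10 - 4 * (C\<^sub>1 + 10 * t) / Q) (at t)"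
    "(\<rho>\<^sub>2 has_real_derivative 10 + 4 * (C\<^sub>1 + 10 * t) / Q) (at t)"
    unfolding \<rho>\<^sub>1_def \<rho>\<^sub>2_def R_def[symmetric]
    by (rule DERIV_diff[OF lin DR] DERIV_add[OF lin DR])+
  moreover have "10 - 4 * (C\<^sub>1 + 10 * t) / Q = 2 * (real 2 + 1 + 2 * real 2 * \<rho>\<^sub>1 t / (\<rho>\<^sub>1 t - \<rho>\<^sub>2 t))"
    "10 + 4 * (C\<^sub>1 + 10 * t) / Q = 2 * (real 2 + 1 + 2 * real 2 * \<rho>\<^sub>2 t / (\<rho>\<^sub>2 t - \<rho>\<^sub>1 t))"
    unfolding r using Q by (simp_all add: field_simps)
  ultimately show "(\<rho>\<^sub>1 has_real_derivative
       2 * (real 2 + 1 + 2 * real 2 * sqrt (\<rho>\<^sub>1 t) ^ 2 / (sqrt (\<rho>\<^sub>1 t) ^ 2 - sqrt (\<rho>\<^sub>2 t) ^ 2))) (at t)"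
    "(\<rho>\<^sub>2 has_real_derivative
       2 * (real 2 + 1 + 2 * real 2 * sqrt (\<rho>\<^sub>2 t) ^ 2 / (sqrt (\<rho>\<^sub>2 t) ^ 2 - sqrt (\<rho>\<^sub>1 t) ^ 2))) (at t)"
    unfolding s by (simp_all only:)
qed

subsection \<open>The two-ring solution\<close>

text \<open>The rates are chosen as functions of \<open>n\<close> before all other data, so they
  depend on neither the initial radii nor the angle. The approximations for large \<open>n\<close>
  are made precise as differences tending to \<open>0\<close>. That the solution has the given form
  is stated as existence together with uniqueness among all solutions.\<close>

theorem proposition4p4:
  "\<exists>\<alpha>\<^sub>3 \<beta>\<^sub>3 :: nat \<Rightarrow> real.
     (\<forall>n\<ge>3. 0 < \<alpha>\<^sub>3 n \<and> \<alpha>\<^sub>3 n < \<beta>\<^sub>3 n \<and>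
        \<alpha>\<^sub>3 n + \<beta>\<^sub>3 n = 8 * real n + 4 \<and>
        \<beta>\<^sub>3 n - \<alpha>\<^sub>3 n = 4 * real n *
          ((\<beta>\<^sub>3 n powr (real n / 2) + \<alpha>\<^sub>3 n powr (real n / 2)) /
           (\<beta>\<^sub>3 n powr (real n / 2) - \<alpha>\<^sub>3 n powr (real n / 2)))) \<and>
     (\<forall>(n::nat) (m\<^sub>0::int) (m :: nat \<Rightarrow> int) (\<theta>\<^sub>0::real) (a\<^sub>1::real) (a\<^sub>2::real) (C\<^sub>1::real) (C\<^sub>2::real).
        n \<ge> 2 \<longrightarrow> m\<^sub>0 = 1 \<or> m\<^sub>0 = -1 \<longrightarrow> (\<forall>j\<in>{1..2*n+1}. m j = m\<^sub>0) \<longrightarrow>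
        0 \<le> \<theta>\<^sub>0 \<longrightarrow> \<theta>\<^sub>0 < 2 * pi \<longrightarrow> 0 < a\<^sub>1 \<longrightarrow> a\<^sub>1 < a\<^sub>2 \<longrightarrow>
        C\<^sub>1 = (a\<^sub>1\<^sup>2 + a\<^sub>2\<^sup>2) / 2 \<longrightarrow> C\<^sub>2 = (a\<^sub>2\<^sup>2 - a\<^sub>1\<^sup>2) / 2 \<longrightarrow>
        (\<exists>\<rho>\<^sub>1 \<rho>\<^sub>2 :: real \<Rightarrow> real.
           (\<forall>t\<ge>0. \<rho>\<^sub>1 t \<ge> 0 \<and> \<rho>\<^sub>2 t \<ge> 0) \<and>
           vortex_solution (2*n+1) m (two_rings n \<theta>\<^sub>0 a\<^sub>1 a\<^sub>2)
             (\<lambda>j t. two_rings n \<theta>\<^sub>0 (sqrt (\<rho>\<^sub>1 t)) (sqrt (\<rho>\<^sub>2 t)) j) \<and>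
           (\<forall>x. vortex_solution (2*n+1) m (two_rings n \<theta>\<^sub>0 a\<^sub>1 a\<^sub>2) x \<longrightarrow>
              (\<forall>t\<ge>0. \<forall>j\<in>{1..2*n+1}.
                 x j t = two_rings n \<theta>\<^sub>0 (sqrt (\<rho>\<^sub>1 t)) (sqrt (\<rho>\<^sub>2 t)) j)) \<and>
           (n = 2 \<longrightarrow> (\<forall>t\<ge>0.
              \<rho>\<^sub>1 t = C\<^sub>1 + 10 * t - sqrt (C\<^sub>2\<^sup>2 + 8 * C\<^sub>1 * t + 40 * t\<^sup>2) \<and>
              \<rho>\<^sub>2 t = C\<^sub>1 + 10 * t + sqrt (C\<^sub>2\<^sup>2 + 8 * C\<^sub>1 * t + 40 * t\<^sup>2))) \<and>
           (n \<ge> 3 \<longrightarrow>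
              \<rho>\<^sub>1 \<sim>[at_top] (\<lambda>t. \<alpha>\<^sub>3 n * t) \<and> \<rho>\<^sub>2 \<sim>[at_top] (\<lambda>t. \<beta>\<^sub>3 n * t)))) \<and>
     (\<lambda>n. \<alpha>\<^sub>3 n - (2 * real n + 2)) \<longlonglongrightarrow> 0 \<and>
     (\<lambda>n. \<beta>\<^sub>3 n - (6 * real n + 2)) \<longlonglongrightarrow> 0"
proof (rule exI[of _ inner_rate], rule exI[of _ outer_rate], intro conjI allI impI)
  fix n :: nat assume "3 \<le> n"
  then have n: "0 < n" by simp
  show "0 < inner_rate n" "inner_rate n < outer_rate n" "inner_rate n + outer_rate n = 8 * real n + 4"
    "outer_rate n - inner_rate n = 4 * real n *
       ((outer_rate n powr (real n / 2) + inner_rate n powr (real n / 2)) /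
        (outer_rate n powr (real n / 2) - inner_rate n powr (real n / 2)))"
    using ring_rates[OF n] by blast+
next
  fix n :: nat and m\<^sub>0 :: int and m :: "nat \<Rightarrow> int" and \<theta>\<^sub>0 a\<^sub>1 a\<^sub>2 C\<^sub>1 C\<^sub>2 :: real
  assume n: "2 \<le> n" and m0: "m\<^sub>0 = 1 \<or> m\<^sub>0 = -1" and m: "\<forall>j\<in>{1..2*n+1}. m j = m\<^sub>0"
    and a: "0 < a\<^sub>1" "a\<^sub>1 < a\<^sub>2"
    and C: "C\<^sub>1 = (a\<^sub>1\<^sup>2 + a\<^sub>2\<^sup>2) / 2" "C\<^sub>2 = (a\<^sub>2\<^sup>2 - a\<^sub>1\<^sup>2) / 2"
  have m0: "m\<^sub>0 * m\<^sub>0 = 1" using m0 by auto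
  let ?explicit = "\<lambda>\<rho>\<^sub>1 \<rho>\<^sub>2. \<forall>t\<ge>0.
     \<rho>\<^sub>1 t = C\<^sub>1 + 10 * t - sqrt (C\<^sub>2\<^sup>2 + 8 * C\<^sub>1 * t + 40 * t\<^sup>2) \<and>
     \<rho>\<^sub>2 t = C\<^sub>1 + 10 * t + sqrt (C\<^sub>2\<^sup>2 + 8 * C\<^sub>1 * t + 40 * t\<^sup>2)"
  let ?asymp = "\<lambda>\<rho>\<^sub>1 \<rho>\<^sub>2. \<rho>\<^sub>1 \<sim>[at_top] (\<lambda>t. inner_rate n * t) \<and> \<rho>\<^sub>2 \<sim>[at_top] (\<lambda>t. outer_rate n * t)"
  let ?solution = "\<lambda>\<rho>\<^sub>1 \<rho>\<^sub>2. vortex_solution (2*n+1) m (two_rings n \<theta>\<^sub>0 a\<^sub>1 a\<^sub>2)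
             (\<lambda>j t. two_rings n \<theta>\<^sub>0 (sqrt (\<rho>\<^sub>1 t)) (sqrt (\<rho>\<^sub>2 t)) j)"
  \<comment> \<open>For \<open>n = 2\<close> the witnesses are the explicit formulas, otherwise the
    functions from \<open>ring_dynamics\<close> started at the squares of the radii.\<close>
  obtain \<rho>\<^sub>1 \<rho>\<^sub>2 :: "real \<Rightarrow> real" where
    pos: "\<And>t. 0 \<le> t \<Longrightarrow> 0 < \<rho>\<^sub>1 t" "\<And>t. 0 \<le> t \<Longrightarrow> \<rho>\<^sub>1 t < \<rho>\<^sub>2 t" and sol: "?solution \<rho>\<^sub>1 \<rho>\<^sub>2"
    and two: "n = 2 \<Longrightarrow> ?explicit \<rho>\<^sub>1 \<rho>\<^sub>2" and three: "3 \<le> n \<Longrightarrow> ?asymp \<rho>\<^sub>1 \<rho>\<^sub>2"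
  proof (cases "n = 2")
    case True
    note dyn = ring_dynamics_two[OF a C]
    show thesis
    proof (rule that)
      show "?solution (\<lambda>t. C\<^sub>1 + 10 * t - sqrt (C\<^sub>2\<^sup>2 + 8 * C\<^sub>1 * t + 40 * t\<^sup>2))
         (\<lambda>t. C\<^sub>1 + 10 * t + sqrt (C\<^sub>2\<^sup>2 + 8 * C\<^sub>1 * t + 40 * t\<^sup>2))"
        unfolding True by (rule two_rings_vortex_solution[OF n[unfolded True] m0 m[unfolded True] dyn])
    qed (use dyn(5,6) True in auto)
  next
    case False
    have "0 < n" using n by simp
    moreover have "0 < a\<^sub>1\<^sup>2" "a\<^sub>1\<^sup>2 < a\<^sub>2\<^sup>2" using a by (auto intro: power_strict_mono)
    ultimately show thesis
    proof (rule ring_dynamics)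
      fix \<rho>\<^sub>1 \<rho>\<^sub>2 :: "real \<Rightarrow> real"
      assume init: "\<rho>\<^sub>1 0 = a\<^sub>1\<^sup>2" "\<rho>\<^sub>2 0 = a\<^sub>2\<^sup>2"
        and cont: "continuous_on {0..} \<rho>\<^sub>1" "continuous_on {0..} \<rho>\<^sub>2"
        and pos: "\<And>t. 0 \<le> t \<Longrightarrow> 0 < \<rho>\<^sub>1 t" "\<And>t. 0 \<le> t \<Longrightarrow> \<rho>\<^sub>1 t < \<rho>\<^sub>2 t"
        and deriv: "\<And>t. 0 < t \<Longrightarrow> (\<rho>\<^sub>1 has_real_derivative
           2 * (real n + 1 + 2 * real n * sqrt (\<rho>\<^sub>1 t) ^ n / (sqrt (\<rho>\<^sub>1 t) ^ n - sqrt (\<rho>\<^sub>2 t) ^ n))) (at t)"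
          "\<And>t. 0 < t \<Longrightarrow> (\<rho>\<^sub>2 has_real_derivative
           2 * (real n + 1 + 2 * real n * sqrt (\<rho>\<^sub>2 t) ^ n / (sqrt (\<rho>\<^sub>2 t) ^ n - sqrt (\<rho>\<^sub>1 t) ^ n))) (at t)"
        and asymp: "\<rho>\<^sub>1 \<sim>[at_top] (\<lambda>t. inner_rate n * t)" "\<rho>\<^sub>2 \<sim>[at_top] (\<lambda>t. outer_rate n * t)"
      have r: "sqrt (\<rho>\<^sub>1 0) = a\<^sub>1" "sqrt (\<rho>\<^sub>2 0) = a\<^sub>2" using a init by simp_all
      have "?solution \<rho>\<^sub>1 \<rho>\<^sub>2"
        by (rule two_rings_vortex_solution[OF n m0 m r cont pos deriv])
      from that[OF pos this] show thesis using asymp False by simp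
    qed
  qed
  show "\<exists>\<rho>\<^sub>1 \<rho>\<^sub>2 :: real \<Rightarrow> real.
           (\<forall>t\<ge>0. \<rho>\<^sub>1 t \<ge> 0 \<and> \<rho>\<^sub>2 t \<ge> 0) \<and> ?solution \<rho>\<^sub>1 \<rho>\<^sub>2 \<and>
           (\<forall>x. vortex_solution (2*n+1) m (two_rings n \<theta>\<^sub>0 a\<^sub>1 a\<^sub>2) x \<longrightarrow>
              (\<forall>t\<ge>0. \<forall>j\<in>{1..2*n+1}.
                 x j t = two_rings n \<theta>\<^sub>0 (sqrt (\<rho>\<^sub>1 t)) (sqrt (\<rho>\<^sub>2 t)) j)) \<and>
           (n = 2 \<longrightarrow> ?explicit \<rho>\<^sub>1 \<rho>\<^sub>2) \<and> (n \<ge> 3 \<longrightarrow> ?asymp \<rho>\<^sub>1 \<rho>\<^sub>2)"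
  proof (rule exI[of _ \<rho>\<^sub>1], rule exI[of _ \<rho>\<^sub>2], intro conjI allI impI ballI)
    show "0 \<le> \<rho>\<^sub>1 t" "0 \<le> \<rho>\<^sub>2 t" if "0 \<le> t" for t using pos[OF that] by simp_all
    show "?solution \<rho>\<^sub>1 \<rho>\<^sub>2" by (rule sol)
    show "x j t = two_rings n \<theta>\<^sub>0 (sqrt (\<rho>\<^sub>1 t)) (sqrt (\<rho>\<^sub>2 t)) j"
      if "vortex_solution (2*n+1) m (two_rings n \<theta>\<^sub>0 a\<^sub>1 a\<^sub>2) x" "0 \<le> t" "j \<in> {1..2*n+1}" for x t j
      by (rule vortex_solution_unique[OF that(1) sol that(2,3)])
  qed (use two three in blast)+
qed (rule ring_rates_limit)+

end
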